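(* Let $n\ge 2$ and $1\le k\le n-1$. Let $\Gamma\subset I(\mathbb{R}^n)$ be a Bieberbach group with translation lattice $\Lambda$ and holonomy group $F=\Lambda\backslash\Gamma\simeq \mathbb{Z}_2^k$, and let $M_\Gamma=\Gamma\backslash\mathbb{R}^n$. Then for every $\mu\ge 0$ the multiplicities of the eigenvalue $4\pi^2\mu$ of $\Delta_f$, $\Delta_e$ and $\Delta_o$ on $M_\Gamma$ are $$d_{f,\mu}(\Gamma)=2^{n-k}\,|\Lambda^*_\mu|,\qquad d_{e,\mu}(\Gamma)=d_{o,\mu}(\Gamma)=2^{n-k-1}\,|\Lambda^*_\mu|.$$ Consequently, if $M_\Gamma$ and $M_{\Gamma'}$ are $n$-dimensional compact flat manifolds with holonomy group $\mathbb{Z}_2^k$ and translation lattices $\Lambda,\Lambda'$, then $M_\Gamma$ and $M_{\Gamma'}$ are isospectral for $\Delta_f$ (resp. for $\Delta_e$, resp. for $\Delta_o$) if and only if $\Lambda$ and $\Lambda'$ are isospectral, i.e. $|\Lambda^*_\mu|=|\Lambda'^*_\mu|$ for all $\mu\ge0$. In particular, for fixed $\Lambda$ and $k$, all compact flat manifolds with holonomy group $\mathbb{Z}_2^k$ and translation lattice $\Lambda$ are mutually $\Delta_f$-, $\Delta_e$- and $\Delta_o$-isospectral.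
   Context: A Bieberbach group is a discrete, cocompact, torsion-free subgroup $\Gamma$ of the isometry group $I(\mathbb{R}^n)\simeq \mathrm{O}(n)\ltimes\mathbb{R}^n$; its translations form a lattice $\Lambda$ (the translation lattice), and $F=\Lambda\backslash\Gamma$ is the holonomy group. $\Lambda^*$ denotes the dual lattice of $\Lambda$ and $\Lambda^*_\mu=\{\lambda\in\Lambda^*:\|\lambda\|^2=\mu\}$. For $0\le p\le n$, $\Delta_p$ is the (nonnegative) Hodge Laplacian acting on smooth $p$-forms of $M_\Gamma$; $\Delta_f=\sum_{p=0}^n\Delta_p$ acts on sections of the full exterior bundle $\bigoplus_{p=0}^n\Lambda^p(TM_\Gamma)$, $\Delta_e=\sum_{p\text{ even}}\Delta_p$ and $\Delta_o=\sum_{p\text{ odd}}\Delta_p$. The multiplicity of an eigenvalue for $\Delta_f$ (resp. $\Delta_e$, $\Delta_o$) is the sum over all $p$ (resp. even $p$, odd $p$) of its multiplicities for $\Delta_p$. Two manifolds are isospectral for an operator if the operators have the same eigenvalues with the same multiplicities. *)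

theory Defs
  imports "HOL-Analysis.Analysis" "HOL-Library.Function_Algebras"
    "HOL-Algebra.Product_Groups" "HOL-Algebra.Coset"
begin

type_synonym 'n isom = "(real^'n^'n) \<times> (real^'n)"

definition iso_mult :: "'n::finite isom \<Rightarrow> 'n isom \<Rightarrow> 'n isom" where
  "iso_mult g h = (fst g ** fst h, fst g *v snd h + snd g)"

definition iso_one :: "'n::finite isom" where
  "iso_one = (mat 1, 0)"

definition iso_inv :: "'n::finite isom \<Rightarrow> 'n isom" where
  "iso_inv g = (transpose (fst g), - (transpose (fst g) *v snd g))"

definition iso_act :: "'n::finite isom \<Rightarrow> real^'n \<Rightarrow> real^'n" where
  "iso_act g x = fst g *v x + snd g"

definition iso_pow :: "'n::finite isom \<Rightarrow> nat \<Rightarrow> 'n isom" where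
  "iso_pow g m = (iso_mult g ^^ m) iso_one"

definition bieberbach :: "'n::finite isom set \<Rightarrow> bool" where
  "bieberbach G \<longleftrightarrow>
     (\<forall>g\<in>G. orthogonal_matrix (fst g)) \<and>
     iso_one \<in> G \<and> (\<forall>g\<in>G. \<forall>h\<in>G. iso_mult g h \<in> G) \<and> (\<forall>g\<in>G. iso_inv g \<in> G) \<and>
     (\<exists>e>0. \<forall>g\<in>G. norm (fst g - mat 1) < e \<and> norm (snd g) < e \<longrightarrow> g = iso_one) \<and>
     (\<exists>K. compact K \<and> (\<forall>x. \<exists>g\<in>G. iso_act g x \<in> K)) \<and>
     (\<forall>g\<in>G. \<forall>m>0. iso_pow g m = iso_one \<longrightarrow> g = iso_one)"

definition isom_group :: "'n::finite isom set \<Rightarrow> 'n isom monoid" where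
  "isom_group G = \<lparr>carrier = G, monoid.mult = iso_mult, one = iso_one\<rparr>"

definition transl_subgroup :: "'n::finite isom set \<Rightarrow> 'n isom set" where
  "transl_subgroup G = {g \<in> G. fst g = mat 1}"

definition transl_lattice :: "'n::finite isom set \<Rightarrow> (real^'n) set" where
  "transl_lattice G = {b. (mat 1, b) \<in> G}"

definition holonomy :: "'n::finite isom set \<Rightarrow> 'n isom set monoid" where
  "holonomy G = isom_group G Mod transl_subgroup G"

definition Z2_pow :: "nat \<Rightarrow> (nat \<Rightarrow> int) monoid" where
  "Z2_pow k = product_group {..<k} (\<lambda>_. integer_mod_group 2)"

definition dual_lattice :: "(real^'n::finite) set \<Rightarrow> (real^'n) set" where
  "dual_lattice L = {y. \<forall>v\<in>L. y \<bullet> v \<in> \<int>}"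

definition dual_shell :: "(real^'n::finite) set \<Rightarrow> real \<Rightarrow> (real^'n) set" where
  "dual_shell L \<mu> = {y \<in> dual_lattice L. norm y ^ 2 = \<mu>}"

text \<open>A (possibly non-homogeneous) form field: at each point x, a function of a
  sequence of tangent vectors. A p-form uses only the arguments 0..p-1.\<close>
type_synonym 'n form = "real^'n \<Rightarrow> (nat \<Rightarrow> real^'n) \<Rightarrow> real"

definition alt_multilinear :: "nat \<Rightarrow> ((nat \<Rightarrow> real^'n::finite) \<Rightarrow> real) \<Rightarrow> bool" where
  "alt_multilinear p f \<longleftrightarrow>
     (\<forall>vs ws. (\<forall>i<p. vs i = ws i) \<longrightarrow> f vs = f ws) \<and>
     (\<forall>i<p. \<forall>vs. linear (\<lambda>v. f (vs(i := v)))) \<and>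
     (\<forall>i<p. \<forall>j<p. \<forall>vs. i \<noteq> j \<and> vs i = vs j \<longrightarrow> f vs = 0)"

coinductive smooth_fun :: "(real^'n::finite \<Rightarrow> real) \<Rightarrow> bool" where
  "(\<forall>x. f differentiable (at x)) \<Longrightarrow>
   (\<forall>v. smooth_fun (\<lambda>x. frechet_derivative f (at x) v)) \<Longrightarrow> smooth_fun f"

definition is_pform :: "nat \<Rightarrow> 'n::finite form \<Rightarrow> bool" where
  "is_pform p \<omega> \<longleftrightarrow> (\<forall>x. alt_multilinear p (\<omega> x)) \<and> (\<forall>vs. smooth_fun (\<lambda>x. \<omega> x vs))"

definition pullback :: "'n::finite isom \<Rightarrow> 'n form \<Rightarrow> 'n form" where
  "pullback g \<omega> = (\<lambda>x vs. \<omega> (iso_act g x) (\<lambda>i. fst g *v vs i))"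

text \<open>Smooth p-forms on M_\<Gamma> = \<Gamma>-invariant smooth p-forms on R^n.\<close>
definition forms :: "'n::finite isom set \<Rightarrow> nat \<Rightarrow> 'n form set" where
  "forms G p = {\<omega>. is_pform p \<omega> \<and> (\<forall>g\<in>G. pullback g \<omega> = \<omega>)}"

definition dder :: "real^'n::finite \<Rightarrow> 'n form \<Rightarrow> 'n form" where
  "dder v \<omega> = (\<lambda>x vs. frechet_derivative (\<lambda>y. \<omega> y vs) (at x) v)"

definition skip_arg :: "nat \<Rightarrow> (nat \<Rightarrow> 'a) \<Rightarrow> nat \<Rightarrow> 'a" where
  "skip_arg i vs = (\<lambda>j. if j < i then vs j else vs (Suc j))"

definition cons_arg :: "'a \<Rightarrow> (nat \<Rightarrow> 'a) \<Rightarrow> nat \<Rightarrow> 'a" where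
  "cons_arg v vs = (\<lambda>j. case j of 0 \<Rightarrow> v | Suc j' \<Rightarrow> vs j')"

text \<open>Exterior derivative of a p-form (flat connection formula).\<close>
definition ext_d :: "nat \<Rightarrow> 'n::finite form \<Rightarrow> 'n form" where
  "ext_d p \<omega> = (\<lambda>x vs. \<Sum>i\<le>p. (-1)^i * dder (vs i) \<omega> x (skip_arg i vs))"

text \<open>Codifferential (formal adjoint of d for the Euclidean metric), on forms
  of positive degree.\<close>
definition codiff :: "'n::finite form \<Rightarrow> 'n form" where
  "codiff \<omega> = (\<lambda>x vs. - (\<Sum>j\<in>UNIV. dder (axis j 1) \<omega> x (cons_arg (axis j 1) vs)))"

text \<open>Hodge Laplacian \<Delta>_p = d \<delta> + \<delta> d on p-forms (\<delta> = 0 on 0-forms).\<close>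
definition hodge_lap :: "nat \<Rightarrow> 'n::finite form \<Rightarrow> 'n form" where
  "hodge_lap p \<omega> = (\<lambda>x vs. (if p = 0 then 0 else ext_d (p - 1) (codiff \<omega>) x vs)
                              + codiff (ext_d p \<omega>) x vs)"

definition fscale :: "real \<Rightarrow> 'n form \<Rightarrow> 'n form" where
  "fscale c \<omega> = (\<lambda>x vs. c * \<omega> x vs)"

definition eigenspace :: "'n::finite isom set \<Rightarrow> nat \<Rightarrow> real \<Rightarrow> 'n form set" where
  "eigenspace G p t = {\<omega> \<in> forms G p. hodge_lap p \<omega> = fscale t \<omega>}"

definition mult_p :: "'n::finite isom set \<Rightarrow> nat \<Rightarrow> real \<Rightarrow> nat" where
  "mult_p G p t = vector_space.dim fscale (eigenspace G p t)"

definition mult_f :: "'n::finite isom set \<Rightarrow> real \<Rightarrow> nat" where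
  "mult_f G t = (\<Sum>p\<le>CARD('n). mult_p G p t)"

definition mult_e :: "'n::finite isom set \<Rightarrow> real \<Rightarrow> nat" where
  "mult_e G t = (\<Sum>p\<in>{p. p \<le> CARD('n) \<and> even p}. mult_p G p t)"

definition mult_o :: "'n::finite isom set \<Rightarrow> real \<Rightarrow> nat" where
  "mult_o G t = (\<Sum>p\<in>{p. p \<le> CARD('n) \<and> odd p}. mult_p G p t)"

definition isospectral :: "('n::finite isom set \<Rightarrow> real \<Rightarrow> nat) \<Rightarrow> 'n isom set \<Rightarrow> 'n isom set \<Rightarrow> bool" where
  "isospectral m G H \<longleftrightarrow> (\<forall>t. m G t = m H t)"

definition lattice_isospectral :: "(real^'n::finite) set \<Rightarrow> (real^'n) set \<Rightarrow> bool" where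
  "lattice_isospectral L L' \<longleftrightarrow>
     (\<forall>\<mu>\<ge>0. card (dual_shell L \<mu>) = card (dual_shell L' \<mu>))"

end

(* On flat space the Hodge Laplacian acts on the coefficients of a form as minus the sum of the second
   derivatives, so an eigenform on the quotient by G is a G-invariant form whose coefficients are
   lattice-periodic eigenfunctions.  These are spanned by the functions cas l = cos + sin with l in the
   shell of the dual lattice: Green's identity kills the other Fourier coefficients, and completeness
   comes from Stone-Weierstrass on the torus.
   The holonomy consists of commuting involutions, hence is diagonal with entries +1, -1 in a common
   basis.  A subset J of this basis gives an elementary form on which the holonomy acts by a character
   chi_J, so the multiplicity on p-forms is the sum over card J = p of the dimension of the
   chi_J-isotypic part of the space of eigenfunctions.  Character sums show that every character of the
   holonomy equals chi_J for exactly 2^(n-k-1) sets J of each parity; the case J even and the case J odd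
   balance because -1 is not in the holonomy, G being torsion-free.  Summing over all characters recovers
   the full space of eigenfunctions. *)
theory Submission
  imports Defs
begin

section \<open>Directional derivatives and the Hodge Laplacian\<close>

text \<open>Forms are real valued, so the Fourier basis is real too: with one function
  \<open>cas l\<close> per frequency, the dimension of an eigenfunction space is a plain count of
  frequencies. No integral basis of the translation lattice is constructed. Cocompactness and
  finiteness of the holonomy provide a real basis consisting of lattice vectors, and Fourier
  analysis is done for the sublattice that it generates. The dual of this sublattice may be larger
  than the wanted dual lattice; the surplus coefficients vanish because eigenfunctions are periodic
  under the whole lattice. Nor is the common eigenbasis of the holonomy chosen orthonormal:
  \<open>U\<close> and its inverse \<open>U'\<close> carry the coordinates, and elementary forms are
  minors in them. In a single degree p the number of sets J with a given character may depend on the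
  group; only the sum over all p of one parity makes it uniform, which is why the result concerns
  the even, odd and full operators.\<close>

definition ddir :: "real^'n::finite \<Rightarrow> (real^'n \<Rightarrow> real) \<Rightarrow> real^'n \<Rightarrow> real" where
  "ddir v f = (\<lambda>x. frechet_derivative f (at x) v)"

lemma smooth_fun_has_derivative:
  assumes "smooth_fun f"
  shows "(f has_derivative (\<lambda>v. ddir v f x)) (at x)"
  using assms unfolding ddir_def
  by (metis frechet_derivative_works smooth_fun.cases)

lemma smooth_fun_ddir: "smooth_fun f \<Longrightarrow> smooth_fun (ddir v f)"
  unfolding ddir_def by (erule smooth_fun.cases) auto

lemma ddir_eqI:
  assumes "\<And>x. (f has_derivative f' x) (at x)"
  shows "ddir v f = (\<lambda>x. f' x v)"
  unfolding ddir_def using frechet_derivative_at[OF assms] by (metis)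

lemma smooth_fun_continuous: "smooth_fun f \<Longrightarrow> continuous_on S f"
  by (meson smooth_fun_has_derivative has_derivative_continuous_on has_derivative_at_withinI)

lemma ddir_add_cmult:
  assumes "smooth_fun f" "smooth_fun g"
  shows "ddir v (\<lambda>x. a * f x + b * g x) = (\<lambda>x. a * ddir v f x + b * ddir v g x)"
  by (rule ddir_eqI) (auto intro!: derivative_eq_intros smooth_fun_has_derivative assms)

text \<open>Combinations of smooth functions with fixed coefficients form a class closed under
  directional derivatives; this class is the invariant of the coinduction.\<close>

lemma smooth_fun_add_cmult:
  assumes "smooth_fun f" "smooth_fun g"
  shows "smooth_fun (\<lambda>x. a * f x + b * g x)"
  using assms
proof (coinduction arbitrary: f g)
  case smooth_fun
  have "((\<lambda>x. a * f x + b * g x) has_derivative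
      (\<lambda>v. a * ddir v f x + b * ddir v g x)) (at x)" for x
    by (auto intro!: derivative_eq_intros smooth_fun_has_derivative smooth_fun)
  moreover have "\<exists>f' g'. (\<lambda>x. frechet_derivative (\<lambda>x. a * f x + b * g x) (at x) v)
      = (\<lambda>x. a * f' x + b * g' x) \<and> smooth_fun f' \<and> smooth_fun g'" for v
    using ddir_add_cmult[OF smooth_fun, of v a b] smooth_fun_ddir[OF smooth_fun(1)]
      smooth_fun_ddir[OF smooth_fun(2)]
    unfolding ddir_def[of v "\<lambda>x. a * f x + b * g x"] by blast
  ultimately show ?case by (auto simp: differentiable_def)
qed

lemma smooth_fun_const: "smooth_fun (\<lambda>x. c)"
  by (coinduction arbitrary: c) (auto simp: frechet_derivative_const)

lemma smooth_fun_cmult: "smooth_fun f \<Longrightarrow> smooth_fun (\<lambda>x. a * f x)"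
  using smooth_fun_add_cmult[of f "\<lambda>x. 0" a 0] by (simp add: smooth_fun_const)

lemma ddir_cmult: "smooth_fun f \<Longrightarrow> ddir v (\<lambda>x. a * f x) = (\<lambda>x. a * ddir v f x)"
  by (rule ddir_eqI) (auto intro!: derivative_eq_intros smooth_fun_has_derivative)

lemma smooth_fun_sum:
  assumes "\<And>i. i \<in> I \<Longrightarrow> smooth_fun (f i)"
  shows "smooth_fun (\<lambda>x. \<Sum>i\<in>I. f i x)"
  using assms
proof (induction I rule: infinite_finite_induct)
  case (insert i I)
  then show ?case using smooth_fun_add_cmult[of "f i" "\<lambda>x. \<Sum>i\<in>I. f i x" 1 1] by simp
qed (auto simp: smooth_fun_const)

lemma ddir_sum:
  assumes "\<And>i. i \<in> I \<Longrightarrow> smooth_fun (f i)"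
  shows "ddir v (\<lambda>x. \<Sum>i\<in>I. f i x) = (\<lambda>x. \<Sum>i\<in>I. ddir v (f i) x)"
  by (rule ddir_eqI) (auto intro!: derivative_eq_intros smooth_fun_has_derivative assms)

lemma smooth_fun_has_field_derivative:
  assumes "smooth_fun f"
  shows "((\<lambda>s. f (x + s *\<^sub>R v)) has_real_derivative ddir v f (x + s *\<^sub>R v)) (at s)"
proof -
  have "((\<lambda>s. f (x + s *\<^sub>R v)) has_derivative (\<lambda>h. ddir (h *\<^sub>R v) f (x + s *\<^sub>R v))) (at s)"
    by (rule has_derivative_compose[OF _ smooth_fun_has_derivative[OF assms]])
      (auto intro!: derivative_eq_intros)
  moreover have "ddir (h *\<^sub>R v) f y = ddir v f y * h" for h y
    using linear_cmul[OF has_derivative_linear[OF smooth_fun_has_derivative[OF assms, of y]]] by simp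
  ultimately show ?thesis by (simp add: has_field_derivative_def)
qed

text \<open>The mean value theorem is applied along \<open>v\<close> to a difference in direction
  \<open>w\<close>, then along \<open>w\<close>. The second difference is symmetric in
  \<open>v\<close> and \<open>w\<close>, so exchanging them compares the two mixed
  derivatives.\<close>

lemma second_difference_mvt:
  assumes f: "smooth_fun f" and h: "h > 0"
  shows "\<exists>\<xi> \<eta>. 0 < \<xi> \<and> \<xi> < h \<and> 0 < \<eta> \<and> \<eta> < h \<and>
    f (x + h *\<^sub>R v + h *\<^sub>R w) - f (x + h *\<^sub>R v) - f (x + h *\<^sub>R w) + f x
      = h * h * ddir w (ddir v f) (x + \<xi> *\<^sub>R v + \<eta> *\<^sub>R w)"
proof -
  define \<phi> where "\<phi> s = f ((x + h *\<^sub>R w) + s *\<^sub>R v) - f (x + s *\<^sub>R v)" for s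
  have d: "(\<phi> has_real_derivative
      ddir v f ((x + h *\<^sub>R w) + s *\<^sub>R v) - ddir v f (x + s *\<^sub>R v)) (at s)" for s
    unfolding \<phi>_def by (intro DERIV_diff smooth_fun_has_field_derivative f)
  obtain \<xi> where \<xi>: "\<xi> > 0" "\<xi> < h" "\<phi> h - \<phi> 0 = (h - 0) *
     (ddir v f ((x + h *\<^sub>R w) + \<xi> *\<^sub>R v) - ddir v f (x + \<xi> *\<^sub>R v))"
    using MVT2[OF h d] by blast
  obtain \<eta> where \<eta>: "\<eta> > 0" "\<eta> < h"
    "ddir v f (x + \<xi> *\<^sub>R v + h *\<^sub>R w) - ddir v f (x + \<xi> *\<^sub>R v + 0 *\<^sub>R w)
      = (h - 0) * ddir w (ddir v f) (x + \<xi> *\<^sub>R v + \<eta> *\<^sub>R w)"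
    using MVT2[OF h, of "\<lambda>s. ddir v f (x + \<xi> *\<^sub>R v + s *\<^sub>R w)"
        "\<lambda>s. ddir w (ddir v f) (x + \<xi> *\<^sub>R v + s *\<^sub>R w)"]
      smooth_fun_has_field_derivative[OF smooth_fun_ddir[OF f]] by blast
  show ?thesis
    using \<xi> \<eta> by (intro exI[of _ \<xi>] exI[of _ \<eta>]) (simp add: \<phi>_def add_ac)
qed

text \<open>For each step size the two mixed derivatives agree, though at different points near
  \<open>x\<close>. Both points tend to \<open>x\<close> as the step tends to 0, and continuity
  finishes.\<close>

lemma ddir_commute:
  assumes f: "smooth_fun f"
  shows "ddir w (ddir v f) = ddir v (ddir w f)"
proof
  fix x
  define P where "P = (\<lambda>st::real\<times>real. x + fst st *\<^sub>R v + snd st *\<^sub>R w)"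
  have lim: "(\<lambda>n. g (P (a n, b n))) \<longlonglongrightarrow> g x"
    if "smooth_fun g" "\<And>n. 0 < a n \<and> a n < inverse (real (Suc n))"
      "\<And>n. 0 < b n \<and> b n < inverse (real (Suc n))" for g a b
  proof -
    have null: "c \<longlonglongrightarrow> 0" if "\<And>n. 0 < c n \<and> c n < inverse (real (Suc n))" for c :: "nat \<Rightarrow> real"
      using that by (intro tendsto_sandwich[OF _ _ tendsto_const LIMSEQ_inverse_real_of_nat]
          always_eventually allI) (simp_all add: less_imp_le)
    have "a \<longlonglongrightarrow> 0" "b \<longlonglongrightarrow> 0"
      by (rule null, fact)+
    then have "(\<lambda>n. x + a n *\<^sub>R v + b n *\<^sub>R w) \<longlonglongrightarrow> x + 0 *\<^sub>R v + 0 *\<^sub>R w"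
      by (intro tendsto_add tendsto_scaleR tendsto_const)
    then have "(\<lambda>n. P (a n, b n)) \<longlonglongrightarrow> x" by (simp add: P_def)
    then show ?thesis
      using smooth_fun_continuous[OF that(1), of UNIV]
      by (intro isCont_tendsto_compose[of x g]) (simp_all add: continuous_on_eq_continuous_at)
  qed
  have "\<forall>n. \<exists>a b a' b'. 0 < a \<and> a < inverse (real (Suc n)) \<and> 0 < b \<and> b < inverse (real (Suc n)) \<and>
    0 < a' \<and> a' < inverse (real (Suc n)) \<and> 0 < b' \<and> b' < inverse (real (Suc n)) \<and>
    ddir w (ddir v f) (P (a, b)) = ddir v (ddir w f) (P (a', b'))"
  proof
    fix n
    define h where "h = inverse (real (Suc n))"
    have h: "h > 0" by (simp add: h_def)
    obtain a b where 1: "0 < a" "a < h" "0 < b" "b < h"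
      "f (x + h *\<^sub>R v + h *\<^sub>R w) - f (x + h *\<^sub>R v) - f (x + h *\<^sub>R w) + f x
      = h * h * ddir w (ddir v f) (x + a *\<^sub>R v + b *\<^sub>R w)"
      using second_difference_mvt[OF f h, of x v w] by blast
    obtain b' a' where 2: "0 < b'" "b' < h" "0 < a'" "a' < h"
      "f (x + h *\<^sub>R w + h *\<^sub>R v) - f (x + h *\<^sub>R w) - f (x + h *\<^sub>R v) + f x
      = h * h * ddir v (ddir w f) (x + b' *\<^sub>R w + a' *\<^sub>R v)"
      using second_difference_mvt[OF f h, of x w v] by blast
    have "h * h * ddir w (ddir v f) (P (a, b)) = h * h * ddir v (ddir w f) (P (a', b'))"
    proof -
      have e: "x + h *\<^sub>R w + h *\<^sub>R v = x + h *\<^sub>R v + h *\<^sub>R w"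
        "x + b' *\<^sub>R w + a' *\<^sub>R v = x + a' *\<^sub>R v + b' *\<^sub>R w"
        by (simp_all add: add_ac)
      show ?thesis using 1(5) 2(5) unfolding e P_def fst_conv snd_conv by linarith
    qed
    then show "\<exists>a b a' b'. 0 < a \<and> a < inverse (real (Suc n)) \<and> 0 < b \<and> b < inverse (real (Suc n)) \<and>
      0 < a' \<and> a' < inverse (real (Suc n)) \<and> 0 < b' \<and> b' < inverse (real (Suc n)) \<and>
      ddir w (ddir v f) (P (a, b)) = ddir v (ddir w f) (P (a', b'))"
      unfolding h_def[symmetric] using 1(1-4) 2(1-4) h
      by (intro exI[of _ a] exI[of _ b] exI[of _ a'] exI[of _ b']) auto
  qed
  then obtain a b a' b' where *: "\<And>n. 0 < a n \<and> a n < inverse (real (Suc n))"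
    "\<And>n. 0 < b n \<and> b n < inverse (real (Suc n))"
    "\<And>n. 0 < a' n \<and> a' n < inverse (real (Suc n))"
    "\<And>n. 0 < b' n \<and> b' n < inverse (real (Suc n))"
    "\<And>n. ddir w (ddir v f) (P (a n, b n)) = ddir v (ddir w f) (P (a' n, b' n))"
    by metis
  note sm = smooth_fun_ddir[OF smooth_fun_ddir[OF f]]
  have "(\<lambda>n. ddir v (ddir w f) (P (a' n, b' n))) \<longlonglongrightarrow> ddir w (ddir v f) x"
    unfolding *(5)[symmetric] by (rule lim[OF sm *(1) *(2)])
  then show "ddir w (ddir v f) x = ddir v (ddir w f) x"
    by (rule LIMSEQ_unique) (rule lim[OF sm *(3) *(4)])
qed

section \<open>The Laplacian on coefficients of forms\<close>

definition lap :: "(real^'n::finite \<Rightarrow> real) \<Rightarrow> real^'n \<Rightarrow> real" where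
  "lap f x = (\<Sum>j\<in>UNIV. ddir (axis j 1) (ddir (axis j 1) f) x)"

lemma lap_cmult: "smooth_fun f \<Longrightarrow> lap (\<lambda>x. a * f x) x = a * lap f x"
  by (simp add: lap_def ddir_cmult smooth_fun_ddir sum_distrib_left)

lemma lap_sum:
  assumes "\<And>i. i \<in> I \<Longrightarrow> smooth_fun (f i)"
  shows "lap (\<lambda>x. \<Sum>i\<in>I. f i x) x = (\<Sum>i\<in>I. lap (f i) x)"
  unfolding lap_def by (subst sum.swap) (simp add: ddir_sum smooth_fun_ddir assms)

lemma dder_ddir: "dder v \<omega> x vs = ddir v (\<lambda>y. \<omega> y vs) x"
  by (simp add: dder_def ddir_def)

lemma cons_arg_simps [simp]:
  "cons_arg v vs 0 = v"
  "cons_arg v vs (Suc i) = vs i"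
  by (simp_all add: cons_arg_def)

lemma skip_cons_arg [simp]:
  "skip_arg 0 (cons_arg v vs) = vs"
  "skip_arg (Suc i) (cons_arg v vs) = cons_arg v (skip_arg i vs)"
  by (auto simp: skip_arg_def cons_arg_def fun_eq_iff split: nat.split)

text \<open>The mixed terms of \<open>d\<delta>\<close> and \<open>\<delta>d\<close> cancel by symmetry of second derivatives.\<close>
lemma hodge_lap_eq_lap:
  assumes \<omega>: "\<And>vs. smooth_fun (\<lambda>x. \<omega> x vs)"
  shows "hodge_lap p \<omega> x vs = - lap (\<lambda>y. \<omega> y vs) x"
proof -
  define c where "c j vs = (\<lambda>y. \<omega> y (cons_arg (axis j 1) vs))" for j vs
  have sc: "smooth_fun (c j vs)" for j vs unfolding c_def by (rule \<omega>)
  \<comment> \<open>The term of index 0 differentiates along the inserted vector \<open>e\<close>;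
    in the other terms the index shift by one produces the minus sign.\<close>
  have ext_cons: "(\<lambda>y. ext_d p \<omega> y (cons_arg e vs)) = (\<lambda>y. ddir e (\<lambda>y. \<omega> y vs) y -
     (\<Sum>i<p. (-1)^i * ddir (vs i) (\<lambda>y. \<omega> y (cons_arg e (skip_arg i vs))) y))" for e
    unfolding ext_d_def dder_ddir
    by (rule ext, subst sum.atMost_shift) (simp add: sum_negf)
  have D: "ddir e (\<lambda>y. ext_d p \<omega> y (cons_arg e vs)) x = ddir e (ddir e (\<lambda>y. \<omega> y vs)) x -
     (\<Sum>i<p. (-1)^i * ddir e (ddir (vs i) (\<lambda>y. \<omega> y (cons_arg e (skip_arg i vs)))) x)" for e
  proof -
    have s: "smooth_fun (\<lambda>y. (-1)^i * ddir (vs i) (\<lambda>y. \<omega> y (cons_arg e (skip_arg i vs))) y)" for i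
      by (intro smooth_fun_cmult smooth_fun_ddir \<omega>)
    have "ddir e (\<lambda>y. ext_d p \<omega> y (cons_arg e vs)) x =
      ddir e (\<lambda>y. 1 * ddir e (\<lambda>y. \<omega> y vs) y + (-1) *
     (\<Sum>i<p. (-1)^i * ddir (vs i) (\<lambda>y. \<omega> y (cons_arg e (skip_arg i vs))) y)) x"
      unfolding ext_cons by simp
    also have "\<dots> = ddir e (ddir e (\<lambda>y. \<omega> y vs)) x -
     (\<Sum>i<p. (-1)^i * ddir e (ddir (vs i) (\<lambda>y. \<omega> y (cons_arg e (skip_arg i vs)))) x)"
      by (subst ddir_add_cmult[OF smooth_fun_ddir[OF \<omega>] smooth_fun_sum[OF s]])
        (simp add: ddir_sum s ddir_cmult smooth_fun_ddir \<omega>)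
    finally show ?thesis .
  qed
  have 1: "codiff (ext_d p \<omega>) x vs = - lap (\<lambda>y. \<omega> y vs) x +
     (\<Sum>j\<in>UNIV. \<Sum>i<p. (-1)^i * ddir (axis j 1) (ddir (vs i) (c j (skip_arg i vs))) x)"
    unfolding codiff_def dder_ddir D lap_def c_def by (simp add: sum_subtractf)
  have cod: "(\<lambda>y. codiff \<omega> y ws) = (\<lambda>y. (-1) * (\<Sum>j\<in>UNIV. ddir (axis j 1) (c j ws) y))" for ws
    unfolding codiff_def dder_ddir c_def by (simp only: mult_minus1)
  have D2: "ddir v (\<lambda>y. codiff \<omega> y ws) x = - (\<Sum>j\<in>UNIV. ddir v (ddir (axis j 1) (c j ws)) x)" for v ws
  proof -
    have s: "smooth_fun (\<lambda>y. \<Sum>j\<in>UNIV. ddir (axis j 1) (c j ws) y)"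
      by (rule smooth_fun_sum) (rule smooth_fun_ddir[OF sc])
    have "ddir v (\<lambda>y. \<Sum>j\<in>UNIV. ddir (axis j 1) (c j ws) y) =
      (\<lambda>y. \<Sum>j\<in>UNIV. ddir v (ddir (axis j 1) (c j ws)) y)"
      by (rule ddir_sum) (rule smooth_fun_ddir[OF sc])
    then show ?thesis unfolding cod ddir_cmult[OF s] by simp
  qed
  show ?thesis
  proof (cases p)
    case 0
    then show ?thesis unfolding hodge_lap_def 1 by simp
  next
    case (Suc q)
    have comm: "ddir (vs i) (ddir (axis j 1) (c j ws)) x = ddir (axis j 1) (ddir (vs i) (c j ws)) x" for i j ws
      by (subst ddir_commute[OF sc]) (rule refl)
    have "ext_d q (codiff \<omega>) x vs =
      - (\<Sum>i<p. \<Sum>j\<in>UNIV. (-1)^i * ddir (vs i) (ddir (axis j 1) (c j (skip_arg i vs))) x)"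
      unfolding ext_d_def dder_ddir D2 Suc
      by (simp add: lessThan_Suc_atMost sum_negf sum_distrib_left)
    also have "\<dots> = - (\<Sum>j\<in>UNIV. \<Sum>i<p. (-1)^i * ddir (axis j 1) (ddir (vs i) (c j (skip_arg i vs))) x)"
      by (subst sum.swap) (simp only: comm)
    finally show ?thesis unfolding hodge_lap_def 1 using Suc by simp
  qed
qed

text \<open>The functions \<open>cas l\<close> and \<open>cas (- l)\<close> span the same space as the cosine and the sine of
  frequency \<open>l\<close>, which indexes a real basis by all frequencies without choosing one of \<open>l\<close> and \<open>- l\<close>.\<close>
definition cas :: "real^'n::finite \<Rightarrow> real^'n \<Rightarrow> real" where
  "cas l x = cos (2 * pi * (l \<bullet> x)) + sin (2 * pi * (l \<bullet> x))"

text \<open>The derivative of cos + sin is cos - sin, the same function at the opposite frequency; a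
  second derivative returns to \<open>cas l\<close>.\<close>

lemma ddir_cas: "ddir v (cas l) = (\<lambda>x. 2 * pi * (l \<bullet> v) * cas (- l) x)"
proof -
  have "(cas l has_derivative (\<lambda>v. 2 * pi * (l \<bullet> v) * cas (- l) x)) (at x)" for x
    unfolding cas_def
    by (auto intro!: derivative_eq_intros simp: fun_eq_iff algebra_simps)
  then show ?thesis by (rule ddir_eqI)
qed

lemma smooth_fun_cas: "smooth_fun (cas l)"
proof -
  \<comment> \<open>The scalar factor makes the family closed under derivatives, as the coinduction
    requires.\<close>
  have "smooth_fun (\<lambda>x. a * cas l x)" for a
  proof (coinduction arbitrary: a l)
    case smooth_fun
    have "((\<lambda>x. a * cas l x) has_derivative (\<lambda>v. a * (2 * pi * (l \<bullet> v)) * cas (- l) x)) (at x)" for x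
      unfolding cas_def
      by (auto intro!: derivative_eq_intros simp: fun_eq_iff algebra_simps)
    note d = this
    have "(\<lambda>x. frechet_derivative (\<lambda>x. a * cas l x) (at x) v) =
       (\<lambda>x. (a * (2 * pi * (l \<bullet> v))) * cas (- l) x)" for v
      using ddir_eqI[OF d, of v] unfolding ddir_def by simp
    with d show ?case by (auto simp: differentiable_def)
  qed
  from this[of 1] show ?thesis by simp
qed

lemma lap_cas: "lap (cas l) x = - (4 * pi^2 * (norm l)^2) * cas l x"
proof -
  have "ddir v (ddir v (cas l)) x = - (4 * pi^2) * cas l x * ((l \<bullet> v) * (l \<bullet> v))" for v
    unfolding ddir_cas[of v l] ddir_cmult[OF smooth_fun_cas] ddir_cas
    by (simp add: power2_eq_square)
  then have "lap (cas l) x = (\<Sum>j\<in>UNIV. - (4 * pi^2) * cas l x * (l $ j * l $ j))"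
    by (simp add: lap_def inner_axis)
  also have "\<dots> = - (4 * pi^2) * cas l x * (l \<bullet> l)"
    by (simp add: inner_vec_def sum_distrib_left)
  finally show ?thesis by (simp add: dot_square_norm)
qed

section \<open>Periodic functions on the unit cube\<close>

definition fscl :: "real \<Rightarrow> ('a \<Rightarrow> real) \<Rightarrow> 'a \<Rightarrow> real" where
  "fscl c f = (\<lambda>x. c * f x)"

interpretation fv: vector_space fscl
  by standard (auto simp: fscl_def fun_eq_iff algebra_simps)

lemma sum_fscl_apply: "(\<Sum>i\<in>I. fscl (c i) (f i)) x = (\<Sum>i\<in>I. c i * f i x)"
  by (induction I rule: infinite_finite_induct) (auto simp: fscl_def)

lemma fv_span_add: "f \<in> fv.span S \<Longrightarrow> g \<in> fv.span S \<Longrightarrow> (\<lambda>x. f x + g x) \<in> fv.span S"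
  using fv.span_add[of f S g] by (simp add: plus_fun_def)

lemma fv_span_cmult: "f \<in> fv.span S \<Longrightarrow> (\<lambda>x. c * f x) \<in> fv.span S"
  using fv.span_scale[of f S c] by (simp add: fscl_def)

lemma fv_span_sum:
  "(\<And>i. i \<in> I \<Longrightarrow> f i \<in> fv.span S) \<Longrightarrow> (\<lambda>x. \<Sum>i\<in>I. f i x) \<in> fv.span S"
proof (induction I rule: infinite_finite_induct)
  case (insert i I)
  then show ?case using fv_span_add[of "f i" S "\<lambda>x. \<Sum>i\<in>I. f i x"] by simp
qed (use fv.span_zero[of S] in \<open>auto simp: zero_fun_def\<close>)

lemma fv_span_induct [consumes 1, case_names zero base]:
  assumes "f \<in> fv.span S" and zero: "P (\<lambda>x. 0)"
    and base: "\<And>c g h. g \<in> S \<Longrightarrow> P h \<Longrightarrow> P (\<lambda>x. c * g x + h x)"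
  shows "P f"
  using assms(1)
proof (induction rule: fv.span_induct_alt)
  case base
  then show ?case using zero by (simp add: zero_fun_def)
next
  case (step c x y)
  then show ?case using assms(3)[of x y c] by (simp add: plus_fun_def fscl_def)
qed

lemma cas_zero [simp]: "cas 0 x = 1"
  by (simp add: cas_def)

lemma cas_plus_right:
  "cas l (x + y) = cos (2 * pi * (l \<bullet> y)) * cas l x + sin (2 * pi * (l \<bullet> y)) * cas (- l) x"
  by (simp add: cas_def inner_add_right distrib_left cos_add sin_add algebra_simps)

text \<open>With phases s and t the product is cos (s - t) + sin (s + t). The cosine is half the
  sum, the sine half the difference, of \<open>cas\<close> at opposite frequencies.\<close>

lemma cas_mult:
  "cas a x * cas b x = (cas (a - b) x + cas (b - a) x + cas (a + b) x - cas (- a - b) x) / 2"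
proof -
  define s t where "s = 2 * pi * (a \<bullet> x)" and "t = 2 * pi * (b \<bullet> x)"
  have "cas (a - b) x = cos (s - t) + sin (s - t)" "cas (b - a) x = cos (t - s) + sin (t - s)"
    "cas (a + b) x = cos (s + t) + sin (s + t)" "cas (- a - b) x = cos (- s - t) + sin (- s - t)"
    by (simp_all add: cas_def s_def t_def inner_diff_left inner_add_left algebra_simps)
  moreover have "cas a x = cos s + sin s" "cas b x = cos t + sin t"
    by (simp_all add: cas_def s_def t_def)
  ultimately show ?thesis
    by (simp add: cos_add sin_add cos_diff sin_diff algebra_simps)
qed

definition int_vecs :: "(real^'n::finite) set" where
  "int_vecs = {m. \<forall>j. m $ j \<in> \<int>}"

lemma int_vecs_add: "a \<in> int_vecs \<Longrightarrow> b \<in> int_vecs \<Longrightarrow> a + b \<in> int_vecs"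
  by (simp add: int_vecs_def)

lemma int_vecs_uminus: "a \<in> int_vecs \<Longrightarrow> - a \<in> int_vecs"
  by (simp add: int_vecs_def)

lemma int_vecs_diff: "a \<in> int_vecs \<Longrightarrow> b \<in> int_vecs \<Longrightarrow> a - b \<in> int_vecs"
  by (simp add: int_vecs_def)

lemma int_vecs_zero: "0 \<in> int_vecs"
  by (simp add: int_vecs_def)

lemma int_vecs_axis: "axis j 1 \<in> int_vecs"
  by (simp add: int_vecs_def axis_def)

text \<open>Trigonometric polynomials form an algebra, which lets polynomials from Stone-Weierstrass
  be pulled back into the span.\<close>

lemma cas_span_mult:
  assumes "f \<in> fv.span (cas ` int_vecs)" "g \<in> fv.span (cas ` int_vecs)"
  shows "(\<lambda>x. f x * g x) \<in> fv.span (cas ` int_vecs)"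
  using assms(1)
proof (induction rule: fv_span_induct)
  case zero
  show ?case using fv.span_zero[of "cas ` int_vecs"] by (simp add: zero_fun_def)
next
  case (base c f' h)
  then obtain a where a: "a \<in> int_vecs" "f' = cas a" by auto
  have "(\<lambda>x. cas a x * g x) \<in> fv.span (cas ` int_vecs)"
    using assms(2)
  proof (induction rule: fv_span_induct)
    case zero
    show ?case using fv.span_zero[of "cas ` int_vecs"] by (simp add: zero_fun_def)
  next
    case (base d g' k)
    then obtain b where b: "b \<in> int_vecs" "g' = cas b" by auto
    have cs: "cas m \<in> fv.span (cas ` int_vecs)" if "m \<in> int_vecs" for m :: "real^'a"
      using that by (intro fv.span_base) auto
    have "(\<lambda>x. d / 2 * cas (a - b) x + (d / 2 * cas (b - a) x + (d / 2 * cas (a + b) x +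
        (- (d / 2) * cas (- a - b) x + cas a x * k x)))) \<in> fv.span (cas ` int_vecs)"
      by (intro fv_span_add fv_span_cmult cs base int_vecs_add int_vecs_diff int_vecs_uminus a b)
    also have "(\<lambda>x. d / 2 * cas (a - b) x + (d / 2 * cas (b - a) x + (d / 2 * cas (a + b) x +
        (- (d / 2) * cas (- a - b) x + cas a x * k x)))) = (\<lambda>x. cas a x * (d * g' x + k x))"
    proof
      fix x
      have "cas a x * (d * g' x + k x) = d * (cas a x * cas b x) + cas a x * k x"
        by (simp add: b algebra_simps)
      then show "d / 2 * cas (a - b) x + (d / 2 * cas (b - a) x + (d / 2 * cas (a + b) x +
        (- (d / 2) * cas (- a - b) x + cas a x * k x))) = cas a x * (d * g' x + k x)"
        unfolding cas_mult by (simp add: field_simps)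
    qed
    finally show ?case .
  qed
  from fv_span_add[OF fv_span_cmult[OF this, of c] base(2)]
  show ?case by (simp add: a algebra_simps)
qed

lemma unit_periodic_int:
  assumes "\<And>x. h (x + v) = (h x :: real)"
  shows "h (x + of_int z *\<^sub>R v) = h (x :: 'a::real_vector)"
proof -
  have nat: "h (x + of_nat n *\<^sub>R v) = h x" for n x
  proof (induction n)
    case (Suc n)
    have "h (x + of_nat (Suc n) *\<^sub>R v) = h ((x + of_nat n *\<^sub>R v) + v)"
      by (simp add: algebra_simps)
    then show ?case by (simp add: assms Suc)
  qed simp
  show ?thesis
  proof (cases "z \<ge> 0")
    case True
    then show ?thesis using nat[of x "nat z"] by simp
  next
    case False
    then show ?thesis using nat[of "x + of_int z *\<^sub>R v" "nat (- z)"] by simp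
  qed
qed

text \<open>Cut the translated cube along the hyperplane where the coordinate is 1 and move the
  overhanging slab back by one period: the two pieces reassemble the unit cube.\<close>

lemma integral_unit_cube_shift1:
  fixes h :: "real^'n::finite \<Rightarrow> real"
  assumes h: "continuous_on UNIV h" and per: "\<And>j x. h (x + axis j 1) = h x"
  shows "integral (cbox 0 1) (\<lambda>x. h (x + s *\<^sub>R axis j 1)) = integral (cbox 0 1) h"
proof -
  define k :: "real^'n" where "k = axis j 1"
  have kB: "k \<in> Basis" by (simp add: k_def)
  have ki: "k $ i = (if i = j then 1 else 0)" for i by (auto simp: k_def axis_def)
  have int: "h integrable_on cbox a b" for a b
    by (rule integrable_continuous) (use h continuous_on_subset in blast)
  have sh: "integral (cbox a b) (\<lambda>x. h (x + c)) = integral (cbox (a + c) (b + c)) h" for a b c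
    using integral_shift_cbox_plus[of a b h c] by (simp add: o_def add.commute)
  have unit: "integral (cbox 0 1) (\<lambda>x. h (x + s *\<^sub>R k)) = integral (cbox 0 1) h"
    if s: "0 \<le> s" "s \<le> 1" for s
  proof -
    have ik: "x \<bullet> k = x $ j" for x by (simp add: k_def inner_axis)
    have 1: "cbox (s *\<^sub>R k) (1 + s *\<^sub>R k) \<inter> {x. x \<bullet> k \<le> 1} = cbox (s *\<^sub>R k) 1"
      "cbox (s *\<^sub>R k) (1 + s *\<^sub>R k) \<inter> {x. x \<bullet> k \<ge> 1} = cbox (0 + k) ((1 - (1 - s) *\<^sub>R k) + k)"
      "cbox 0 1 \<inter> {x. x \<bullet> k \<le> s} = cbox 0 (1 - (1 - s) *\<^sub>R k)"
      "cbox 0 1 \<inter> {x. x \<bullet> k \<ge> s} = cbox (s *\<^sub>R k) 1"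
      using s by (auto simp: mem_box_cart ki ik split: if_splits; smt (verit) s)+
    have "integral (cbox 0 1) (\<lambda>x. h (x + s *\<^sub>R k)) = integral (cbox (s *\<^sub>R k) (1 + s *\<^sub>R k)) h"
      using sh[of 0 1 "s *\<^sub>R k"] by simp
    also have "\<dots> = integral (cbox (s *\<^sub>R k) 1) h + integral (cbox (0 + k) ((1 - (1 - s) *\<^sub>R k) + k)) h"
      using integral_split[OF int kB, of "s *\<^sub>R k" "1 + s *\<^sub>R k" 1] unfolding 1 .
    also have "integral (cbox (0 + k) ((1 - (1 - s) *\<^sub>R k) + k)) h = integral (cbox 0 (1 - (1 - s) *\<^sub>R k)) h"
      unfolding sh[symmetric] by (simp add: k_def per)
    also have "integral (cbox (s *\<^sub>R k) 1) h + integral (cbox 0 (1 - (1 - s) *\<^sub>R k)) h = integral (cbox 0 1) h"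
      using integral_split[OF int kB, of 0 1 s] unfolding 1 by simp
    finally show ?thesis .
  qed
  \<comment> \<open>An arbitrary shift is reduced to its fractional part by periodicity.\<close>
  have "h (x + s *\<^sub>R k) = h (x + frac s *\<^sub>R k)" for x
    using unit_periodic_int[of h k "x + frac s *\<^sub>R k" "\<lfloor>s\<rfloor>"] per[of _ j, folded k_def]
    by (simp add: frac_def algebra_simps)
  then show ?thesis
    using unit[of "frac s"] by (simp add: k_def frac_lt_1 less_imp_le)
qed

lemma integral_unit_cube_shift:
  fixes h :: "real^'n::finite \<Rightarrow> real"
  assumes h: "continuous_on UNIV h" and per: "\<And>j x. h (x + axis j 1) = h x"
  shows "integral (cbox 0 1) (\<lambda>x. h (x + a)) = integral (cbox 0 1) h"
proof -
  \<comment> \<open>The shift is built up one coordinate at a time; \<open>J\<close> holds the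
    coordinates already shifted.\<close>
  have "integral (cbox 0 1) (\<lambda>x. h (x + (\<Sum>j\<in>J. a $ j *\<^sub>R axis j 1))) = integral (cbox 0 1) h" for J
  proof (induction J rule: infinite_finite_induct)
    case (insert j J)
    define b where "b = (\<Sum>j\<in>J. a $ j *\<^sub>R (axis j 1 :: real^'n))"
    have "integral (cbox 0 1) (\<lambda>x. h (x + a $ j *\<^sub>R axis j 1 + b)) = integral (cbox 0 1) (\<lambda>x. h (x + b))"
    proof (rule integral_unit_cube_shift1)
      show "continuous_on UNIV (\<lambda>x. h (x + b))"
        by (rule continuous_on_compose2[OF h]) (auto intro!: continuous_intros)
      show "h (x + axis j 1 + b) = h (x + b)" for x j
        using per[of "x + b" j] by (simp add: add_ac)
    qed
    then show ?case using insert by (simp add: b_def add_ac)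
  qed auto
  moreover have "(\<Sum>j\<in>UNIV. a $ j *\<^sub>R axis j 1) = a"
    by (simp add: vec_eq_iff axis_def if_distrib cong: if_cong)
  ultimately show ?thesis by metis
qed

text \<open>A periodic function factors through the torus: equal values of \<open>cis\<close> mean
  that the coordinates differ by integers.\<close>

lemma unit_periodic_cis_eq:
  fixes h :: "real^'n::finite \<Rightarrow> real"
  assumes per: "\<And>j x. h (x + axis j 1) = h x"
    and eq: "\<And>j. cis (2 * pi * x $ j) = cis (2 * pi * y $ j)"
  shows "h x = h y"
proof -
  have "\<exists>z::int. x $ j = y $ j + z" for j
  proof -
    have "sin (2 * pi * x $ j) = sin (2 * pi * y $ j) \<and> cos (2 * pi * x $ j) = cos (2 * pi * y $ j)"
      using eq[of j] by (simp add: complex_eq_iff)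
    then obtain n :: int where "2 * pi * x $ j = 2 * pi * y $ j + 2 * pi * n"
      unfolding sin_cos_eq_iff by blast
    then have "2 * pi * x $ j = 2 * pi * (y $ j + n)" by (simp add: algebra_simps)
    then show ?thesis by auto
  qed
  then obtain z :: "'n \<Rightarrow> int" where z: "\<And>j. x $ j = y $ j + z j" by metis
  have "h (y + (\<Sum>j\<in>J. of_int (z j) *\<^sub>R axis j 1)) = h y" for J
  proof (induction J rule: infinite_finite_induct)
    case (insert j J)
    then show ?case
      using unit_periodic_int[of h "axis j 1" "y + (\<Sum>j\<in>J. of_int (z j) *\<^sub>R axis j 1)" "z j"] per
      by (simp add: add_ac)
  qed auto
  moreover have "x = y + (\<Sum>j\<in>UNIV. of_int (z j) *\<^sub>R axis j 1)"
    by (simp add: vec_eq_iff z axis_def if_distrib cong: if_cong)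
  ultimately show ?thesis by metis
qed

text \<open>The map \<open>E\<close> realises the torus as a compact set in complex space. The
  function descends to it, is approximated there by a polynomial, and the polynomial in cosines and
  sines is pulled back.\<close>

lemma unit_periodic_cas_approx:
  fixes h :: "real^'n::finite \<Rightarrow> real"
  assumes h: "continuous_on UNIV h" and per: "\<And>j x. h (x + axis j 1) = h x" and e: "e > 0"
  shows "\<exists>p \<in> fv.span (cas ` int_vecs). \<forall>x. \<bar>h x - p x\<bar> < e"
proof -
  define E :: "real^'n \<Rightarrow> complex^'n" where "E x = (\<chi> j. cis (2 * pi * x $ j))" for x
  define Q :: "(real^'n) set" where "Q = cbox 0 1"
  have contE: "continuous_on S E" for S
    unfolding E_def by (intro continuous_intros)
  have inQ: "\<exists>y\<in>Q. E y = E x" for x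
  proof -
    have "(\<chi> j. frac (x $ j)) \<in> Q"
      by (auto simp: Q_def mem_box_cart frac_lt_1 less_imp_le)
    moreover have "cis (2 * pi * frac t) = cis (2 * pi * t)" for t
    proof -
      have "2 * pi * frac t = 2 * pi * t - 2 * pi * of_int \<lfloor>t\<rfloor>"
        by (simp add: frac_def algebra_simps)
      then show ?thesis by (simp add: complex_eq_iff cos_diff sin_diff)
    qed
    ultimately show ?thesis by (intro bexI[of _ "\<chi> j. frac (x $ j)"]) (auto simp: E_def)
  qed
  have hE: "h x = h y" if "E x = E y" for x y
    by (rule unit_periodic_cis_eq[OF per]) (use that in \<open>simp add: E_def vec_eq_iff\<close>)
  \<comment> \<open>The choice of a preimage is harmless, since \<open>h\<close> is constant on the
    fibres of \<open>E\<close>.\<close>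
  define g where "g w = h (SOME y. E y = w)" for w
  have gE: "g (E x) = h x" for x
    unfolding g_def by (rule hE) (rule someI[of "\<lambda>y. E y = E x"], simp)
  have comp: "compact (E ` Q)"
    unfolding Q_def by (intro compact_continuous_image contE compact_cbox)
  have "continuous_on (E ` Q) g"
  proof (subst continuous_on_closed_vimage)
    show "closed (E ` Q)" by (rule compact_imp_closed[OF comp])
    show "\<forall>B. closed B \<longrightarrow> closed (g -` B \<inter> E ` Q)"
    proof (intro allI impI)
      fix B :: "real set" assume "closed B"
      then have "closed (h -` B)" using h by (rule closed_vimage)
      \<comment> \<open>Continuity of \<open>g\<close> holds because preimages of closed sets are
        images under \<open>E\<close> of compact subsets of the cube.\<close>
      then have "compact (Q \<inter> h -` B)" unfolding Q_def by (intro compact_Int_closed compact_cbox)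
      then have "closed (E ` (Q \<inter> h -` B))"
        by (intro compact_imp_closed compact_continuous_image contE)
      also have "E ` (Q \<inter> h -` B) = g -` B \<inter> E ` Q" by (auto simp: gE)
      finally show "closed (g -` B \<inter> E ` Q)" .
    qed
  qed
  from Stone_Weierstrass_real_polynomial_function[OF comp this e]
  obtain p where p: "real_polynomial_function p" "\<And>w. w \<in> E ` Q \<Longrightarrow> \<bar>g w - p w\<bar> < e"
    by blast
  have cs: "cas m \<in> fv.span (cas ` int_vecs)" if "m \<in> int_vecs" for m :: "real^'n"
    using that by (intro fv.span_base) auto
  have "(\<lambda>x. p (E x)) \<in> fv.span (cas ` int_vecs)"
    using p(1)
  proof induction
    case (linear f)
    then interpret bounded_linear f .
    \<comment> \<open>Cosine and sine are half the sum and half the difference of \<open>cas\<close>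
      at frequencies \<open>axis j 1\<close> and \<open>- axis j 1\<close>; these give the
      coefficients.\<close>
    have "f (E x) = (\<Sum>j\<in>UNIV. (f (axis j 1) + f (axis j \<i>)) / 2 * cas (axis j 1) x
        + (f (axis j 1) - f (axis j \<i>)) / 2 * cas (- axis j 1) x)" for x
    proof -
      have "E x = (\<Sum>j\<in>UNIV. cos (2 * pi * x $ j) *\<^sub>R axis j 1 + sin (2 * pi * x $ j) *\<^sub>R axis j \<i>)"
        by (simp add: E_def vec_eq_iff axis_def if_distrib sum.distrib complex_eq_iff cong: if_cong)
      then have "f (E x) = (\<Sum>j\<in>UNIV. cos (2 * pi * x $ j) * f (axis j 1) + sin (2 * pi * x $ j) * f (axis j \<i>))"
        by (simp add: sum add scaleR)
      also have "\<dots> = (\<Sum>j\<in>UNIV. (f (axis j 1) + f (axis j \<i>)) / 2 * cas (axis j 1) x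
        + (f (axis j 1) - f (axis j \<i>)) / 2 * cas (- axis j 1) x)"
        by (intro sum.cong refl) (simp add: cas_def inner_axis' field_simps)
      finally show ?thesis .
    qed
    then show ?case
      by (simp only:) (intro fv_span_sum fv_span_add fv_span_cmult cs int_vecs_axis int_vecs_uminus)
  next
    case (const c)
    show ?case using fv_span_cmult[OF cs[OF int_vecs_zero], of c] by simp
  qed (auto intro: fv_span_add cas_span_mult)
  moreover have "\<bar>h x - p (E x)\<bar> < e" for x
    using p(2)[of "E x"] inQ[of x] gE[of x] by (metis imageI)
  ultimately show ?thesis by (intro bexI[of _ "\<lambda>x. p (E x)"]) auto
qed

section \<open>Eigenfunctions periodic under a lattice\<close>

lemma cas_periodic:
  assumes "l \<bullet> v \<in> \<int>"
  shows "cas l (x + v) = cas l x"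
proof -
  obtain z where z: "l \<bullet> v = of_int z" using assms by (elim Ints_cases)
  show ?thesis unfolding cas_plus_right z by simp
qed

lemma cas_continuous: "continuous_on S (cas l)"
  by (rule smooth_fun_continuous[OF smooth_fun_cas])

lemma finite_bounded_int_vecs: "finite {m \<in> int_vecs. \<forall>j. \<bar>m $ j\<bar> \<le> (N::real)}"
proof (rule finite_subset)
  show "finite ((\<lambda>g. \<chi> j. of_int (g j)) ` (UNIV \<rightarrow>\<^sub>E {- \<lceil>N\<rceil>..\<lceil>N\<rceil>}) :: (real^'n::finite) set)"
    by (intro finite_imageI finite_PiE) auto
  show "{m \<in> int_vecs. \<forall>j. \<bar>m $ j\<bar> \<le> N} \<subseteq> (\<lambda>g. \<chi> j. of_int (g j)) ` (UNIV \<rightarrow>\<^sub>E {- \<lceil>N\<rceil>..\<lceil>N\<rceil>})"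
  proof
    fix m :: "real^'n" assume m: "m \<in> {m \<in> int_vecs. \<forall>j. \<bar>m $ j\<bar> \<le> N}"
    have i: "of_int \<lfloor>m $ j\<rfloor> = m $ j" for j using m by (simp add: int_vecs_def)
    have b: "\<lfloor>m $ j\<rfloor> \<in> {- \<lceil>N\<rceil>..\<lceil>N\<rceil>}" for j
    proof -
      have "\<bar>m $ j\<bar> \<le> N" using m by simp
      then have "real_of_int \<lfloor>m $ j\<rfloor> \<le> of_int \<lceil>N\<rceil>" "of_int (- \<lceil>N\<rceil>) \<le> real_of_int \<lfloor>m $ j\<rfloor>"
        unfolding i of_int_minus using le_of_int_ceiling[of N] by linarith+
      then show ?thesis by (simp only: of_int_le_iff atLeastAtMost_iff)
    qed
    show "m \<in> (\<lambda>g. \<chi> j. of_int (g j)) ` (UNIV \<rightarrow>\<^sub>E {- \<lceil>N\<rceil>..\<lceil>N\<rceil>})"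
      by (rule image_eqI[of _ _ "\<lambda>j. \<lfloor>m $ j\<rfloor>"]) (simp add: vec_eq_iff i, use b in \<open>auto simp: PiE_def extensional_def\<close>)
  qed
qed

lemma ddir_shift:
  assumes "smooth_fun f"
  shows "ddir v (\<lambda>x. f (x + a)) = (\<lambda>x. ddir v f (x + a))"
proof (rule ddir_eqI)
  fix x
  have "((\<lambda>x. x + a) has_derivative (\<lambda>h. h)) (at x)" by (auto intro!: derivative_eq_intros)
  from has_derivative_compose[OF this smooth_fun_has_derivative[OF assms]]
  show "((\<lambda>x. f (x + a)) has_derivative (\<lambda>v. ddir v f (x + a))) (at x)" .
qed

text \<open>The rows of \<open>A\<close> span the sublattice along whose fundamental domain functions are averaged.\<close>
locale period_matrix =
  fixes A :: "real^'n::finite^'n"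
  assumes invertible: "invertible A"
begin

definition per :: "(real^'n \<Rightarrow> real) \<Rightarrow> bool" where
  "per f \<longleftrightarrow> (\<forall>j x. f (x + A $ j) = f x)"

text \<open>Pulling back to the unit cube gives the average over the parallelepiped spanned by the
  rows of \<open>A\<close>, with no volume factor.\<close>

definition mean :: "(real^'n \<Rightarrow> real) \<Rightarrow> real" where
  "mean f = integral (cbox 0 1) (\<lambda>x. f (x v* A))"

text \<open>This is the dual of the lattice generated by the rows of \<open>A\<close>.\<close>

definition dual :: "(real^'n) set" where
  "dual = {l. A *v l \<in> int_vecs}"

lemma obtain_inverse: obtains A' where "A ** A' = mat 1" "A' ** A = mat 1"
  using invertible unfolding invertible_def by blast

lemma axis_mult_A: "axis j 1 v* A = A $ j"
  using matrix_vector_mult_basis[of "transpose A" j] by (simp add: row_def)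

lemma continuous_mult_A: "continuous_on S (\<lambda>x. x v* A)"
  using linear_continuous_on[OF matrix_vector_mul_bounded_linear[of "transpose A"], of S] by simp

lemma continuous_comp_A:
  fixes f :: "real^'n \<Rightarrow> real"
  assumes "continuous_on UNIV f"
  shows "continuous_on S (\<lambda>x. f (x v* A))"
  by (rule continuous_on_compose2[OF assms continuous_mult_A]) simp

lemma per_comp_A: "per f \<Longrightarrow> f ((x + axis j 1) v* A) = f (x v* A)"
  by (simp add: vector_matrix_left_distrib axis_mult_A per_def)

lemma integrable_comp_A:
  fixes f :: "real^'n \<Rightarrow> real"
  assumes "continuous_on UNIV f"
  shows "(\<lambda>x. f (x v* A)) integrable_on cbox a b"
  by (rule integrable_continuous[OF continuous_comp_A[OF assms]])

lemma mean_shift: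
  assumes f: "continuous_on UNIV f" "per f"
  shows "mean (\<lambda>x. f (x + a)) = mean f"
proof -
  obtain A' where "A' ** A = mat 1" by (rule obtain_inverse)
  then have "(a v* A') v* A = a" by (simp add: vector_matrix_mul_assoc)
  then obtain y where y: "y v* A = a" by blast
  have "integral (cbox 0 1) (\<lambda>x. f ((x + y) v* A)) = integral (cbox 0 1) (\<lambda>x. f (x v* A))"
    using integral_unit_cube_shift[OF continuous_comp_A[OF f(1)] per_comp_A[OF f(2)]] .
  then show ?thesis by (simp add: mean_def vector_matrix_left_distrib y)
qed

lemma mean_add_cmult:
  assumes "continuous_on UNIV f" "continuous_on UNIV g"
  shows "mean (\<lambda>x. a * f x + b * g x) = a * mean f + b * mean g"
  unfolding mean_def
  by (subst integral_add) (intro integrable_on_cmult_left[where 'b=real, simplified] integrable_comp_A assms | simp)+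

lemma mean_cmult: "mean (\<lambda>x. a * f x) = a * mean f"
  by (simp add: mean_def)

lemma mean_sum:
  assumes "\<And>i. i \<in> I \<Longrightarrow> continuous_on UNIV (f i)"
  shows "mean (\<lambda>x. \<Sum>i\<in>I. f i x) = (\<Sum>i\<in>I. mean (f i))"
  using assms
proof (induction I rule: infinite_finite_induct)
  case (insert i I)
  then show ?case
    using mean_add_cmult[of "f i" "\<lambda>x. \<Sum>i\<in>I. f i x" 1 1]
    by (simp add: continuous_on_sum)
qed (auto simp: mean_def)

lemma per_cas: "l \<in> dual \<Longrightarrow> per (cas l)"
  by (auto simp: per_def dual_def int_vecs_def matrix_vector_mul_component inner_commute
      intro!: cas_periodic)

lemma dual_uminus: "a \<in> dual \<Longrightarrow> - a \<in> dual"
  using int_vecs_uminus linear_neg[OF matrix_vector_mul_linear, of A a] by (auto simp: dual_def)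

lemma dual_add: "a \<in> dual \<Longrightarrow> b \<in> dual \<Longrightarrow> a + b \<in> dual"
  using int_vecs_add by (auto simp: dual_def matrix_vector_right_distrib)

lemma dual_diff: "a \<in> dual \<Longrightarrow> b \<in> dual \<Longrightarrow> a - b \<in> dual"
  using dual_add[of a "- b"] dual_uminus by simp

lemma inj_A: "A *v x = A *v y \<Longrightarrow> x = y"
proof -
  assume *: "A *v x = A *v y"
  obtain A' where "A' ** A = mat 1" by (rule obtain_inverse)
  then show "x = y" using arg_cong[OF *, of "(*v) A'"] by (simp add: matrix_vector_mul_assoc)
qed

text \<open>For nonzero \<open>l\<close> a multiple \<open>v\<close> of a row of \<open>A\<close>
  satisfies l . v = 1/2. Translation by \<open>v\<close> negates \<open>cas l\<close> but preserves
  the mean.\<close>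

lemma mean_cas:
  assumes "l \<in> dual"
  shows "mean (cas l) = (if l = 0 then 1 else 0)"
proof (cases "l = 0")
  case True
  have "(0::real^'n) \<in> cbox 0 1" by (simp add: mem_box_cart)
  then have "measure lborel (cbox 0 (1::real^'n)) = 1" by (subst content_cbox_cart) auto
  then show ?thesis using True by (simp add: mean_def)
next
  case False
  then have "A *v l \<noteq> 0" using inj_A[of l 0] by auto
  then obtain j where j: "(A *v l) $ j \<noteq> 0" by (auto simp: vec_eq_iff)
  define v where "v = (1 / (2 * (A *v l) $ j)) *\<^sub>R A $ j"
  have v: "l \<bullet> v = 1 / 2"
    using j by (simp add: v_def matrix_vector_mul_component inner_commute)
  have "cas l (x + v) = (- 1) * cas l x" for x
    unfolding cas_plus_right v by simp
  then have "mean (cas l) = mean (\<lambda>x. (- 1) * cas l x)"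
    using mean_shift[OF cas_continuous per_cas[OF assms], of v] by simp
  also have "\<dots> = - mean (cas l)" by (subst mean_cmult) simp
  finally show ?thesis using False by simp
qed

text \<open>In the product formula the two sum frequencies are opposite and have equal means, so
  they cancel. The two difference terms contribute 1/2 each exactly when
  \<open>a = b\<close>.\<close>

lemma mean_cas_cas:
  assumes "a \<in> dual" "b \<in> dual"
  shows "mean (\<lambda>x. cas a x * cas b x) = (if a = b then 1 else 0)"
proof -
  have "mean (\<lambda>x. cas a x * cas b x) =
    mean (\<lambda>x. 1/2 * ((1 * cas (a - b) x + 1 * cas (b - a) x)) +
      1/2 * (1 * cas (a + b) x + (-1) * cas (- a - b) x))"
    by (intro arg_cong[of _ _ mean] ext) (simp add: cas_mult field_simps)
  also have "\<dots> = 1/2 * (mean (cas (a - b)) + mean (cas (b - a)))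
     + 1/2 * (mean (cas (a + b)) - mean (cas (- a - b)))"
    by (subst mean_add_cmult mean_add_cmult[OF cas_continuous cas_continuous];
        (intro continuous_intros cas_continuous)?)+ simp
  also have "\<dots> = (if a = b then 1 else 0)"
  proof -
    have e: "- a - b = - (a + b)" "b - a = - (a - b)" by simp_all
    show ?thesis unfolding e
      by (simp add: mean_cas dual_add dual_diff dual_uminus assms del: minus_add_distrib minus_diff_eq)
  qed
  finally show ?thesis .
qed

lemma cas_approx:
  assumes f: "continuous_on UNIV f" "per f" and e: "e > 0"
  shows "\<exists>p \<in> fv.span (cas ` dual). \<forall>x. \<bar>f x - p x\<bar> < e"
proof -
  obtain q where q: "q \<in> fv.span (cas ` int_vecs)" "\<And>x. \<bar>f (x v* A) - q x\<bar> < e"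
    using unit_periodic_cas_approx[OF continuous_comp_A[OF f(1)] per_comp_A[OF f(2)] e] by blast
  obtain A' where A': "A ** A' = mat 1" "A' ** A = mat 1" by (rule obtain_inverse)
  have "(\<lambda>x. q (x v* A')) \<in> fv.span (cas ` dual)"
    using q(1)
  proof (induction rule: fv_span_induct)
    case zero
    show ?case using fv.span_zero[of "cas ` dual"] by (simp add: zero_fun_def)
  next
    case (base c g h)
    then obtain m where m: "m \<in> int_vecs" "g = cas m" by auto
    have "g (x v* A') = cas (A' *v m) x" for x
      using dot_lmul_matrix[of x A' m] by (simp add: m cas_def inner_commute)
    moreover have "A' *v m \<in> dual" using m(1) by (simp add: dual_def matrix_vector_mul_assoc A')
    ultimately have "(\<lambda>x. g (x v* A')) \<in> fv.span (cas ` dual)"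
      by (auto intro!: fv.span_base)
    from fv_span_add[OF fv_span_cmult[OF this] base(2)] show ?case .
  qed
  moreover have "\<bar>f x - q (x v* A')\<bar> < e" for x
    using q(2)[of "x v* A'"] by (simp add: vector_matrix_mul_assoc A')
  ultimately show ?thesis by (intro bexI[of _ "\<lambda>x. q (x v* A')"]) auto
qed

lemma span_cas_continuous: "p \<in> fv.span (cas ` S) \<Longrightarrow> continuous_on UNIV p"
  by (induction rule: fv_span_induct) (auto intro!: continuous_intros cas_continuous)

text \<open>Since \<open>f\<close> is orthogonal to every trigonometric polynomial p, the mean of
  f^2 equals that of f (f - p), which is arbitrarily small. A continuous nonnegative function with
  integral 0 vanishes.\<close>

lemma cas_complete:
  assumes f: "continuous_on UNIV f" "per f"
    and orth: "\<And>l. l \<in> dual \<Longrightarrow> mean (\<lambda>x. f x * cas l x) = 0"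
  shows "f x = 0"
proof -
  have op: "mean (\<lambda>x. f x * p x) = 0" if "p \<in> fv.span (cas ` dual)" for p
  proof -
    have "continuous_on UNIV p \<and> mean (\<lambda>x. f x * p x) = 0"
      using that
    proof (induction rule: fv_span_induct)
      case (base c g h)
      then obtain l where l: "l \<in> dual" "g = cas l" by auto
      have "mean (\<lambda>x. f x * (c * g x + h x)) = mean (\<lambda>x. c * (f x * g x) + 1 * (f x * h x))"
        by (simp add: algebra_simps)
      also have "\<dots> = 0"
        using base l orth by (subst mean_add_cmult) (auto intro!: continuous_intros f cas_continuous)
      finally show ?case using base l by (auto intro!: continuous_intros cas_continuous)
    qed (auto simp: mean_def)
    then show ?thesis by blast
  qed
  let ?h = "\<lambda>x. f (x v* A)"
  have hc: "continuous_on S ?h" for S by (rule continuous_comp_A[OF f(1)])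
  have "bounded (?h ` cbox 0 1)"
    by (intro compact_imp_bounded compact_continuous_image hc compact_cbox)
  then obtain K where K: "\<And>x. x \<in> cbox 0 1 \<Longrightarrow> \<bar>?h x\<bar> \<le> K" and K0: "K > 0"
    by (auto simp: bounded_pos)
  have one: "measure lborel (cbox 0 (1::real^'n)) = 1"
  proof -
    have "(0::real^'n) \<in> cbox 0 1" by (simp add: mem_box_cart)
    then show ?thesis by (subst content_cbox_cart) auto
  qed
  have le: "mean (\<lambda>x. f x * f x) \<le> K * e" if e: "e > 0" for e
  proof -
    obtain p where p: "p \<in> fv.span (cas ` dual)" "\<And>x. \<bar>f x - p x\<bar> < e"
      using cas_approx[OF f e] by blast
    note pc = span_cas_continuous[OF p(1)]
    have "mean (\<lambda>x. f x * f x) = mean (\<lambda>x. 1 * (f x * p x) + 1 * (f x * (f x - p x)))"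
      by (simp add: algebra_simps)
    also have "\<dots> = mean (\<lambda>x. f x * (f x - p x))"
      by (subst mean_add_cmult) (auto intro!: continuous_intros f pc simp: op[OF p(1)])
    also have "\<dots> \<le> integral (cbox 0 (1::real^'n)) (\<lambda>x. K * e)"
      unfolding mean_def
    proof (rule integral_le)
      show "(\<lambda>x. ?h x * (?h x - p (x v* A))) integrable_on cbox 0 1"
        by (intro integrable_continuous continuous_intros hc continuous_comp_A pc)
      show "?h x * (?h x - p (x v* A)) \<le> K * e" if "x \<in> cbox 0 1" for x
      proof -
        have "\<bar>?h x\<bar> * \<bar>?h x - p (x v* A)\<bar> \<le> K * e"
          using K[OF that] p(2)[of "x v* A"] K0 by (intro mult_mono) auto
        then show ?thesis by (metis abs_mult abs_le_D1)
      qed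
    qed (rule integrable_const)
    also have "\<dots> = K * e" by (simp add: one)
    finally show ?thesis .
  qed
  have "mean (\<lambda>x. f x * f x) \<le> 0"
  proof (rule field_le_epsilon)
    fix e :: real assume "e > 0"
    then show "mean (\<lambda>x. f x * f x) \<le> 0 + e" using le[of "e / K"] K0 by simp
  qed
  moreover have sq: "continuous_on S (\<lambda>x. ?h x * ?h x)" for S by (intro continuous_intros hc)
  moreover have "mean (\<lambda>x. f x * f x) \<ge> 0"
    unfolding mean_def by (intro integral_nonneg integrable_continuous sq) auto
  ultimately have "((\<lambda>x. ?h x * ?h x) has_integral 0) (cbox 0 1)"
    using integrable_integral[OF integrable_continuous[OF sq], of 0 1] unfolding mean_def by simp
  moreover have "box 0 (1::real^'n) \<noteq> {}"
  proof -
    have "(\<chi> i. 1/2) \<in> box 0 (1::real^'n)" by (simp add: mem_box_cart)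
    then show ?thesis by blast
  qed
  ultimately have h0: "?h x = 0" if "x \<in> cbox 0 1" for x
    using has_integral_0_cbox_imp_0[OF sq _ _ _ that] by simp
  obtain A' where A': "A' ** A = mat 1" by (rule obtain_inverse)
  define y where "y = x v* A'"
  \<comment> \<open>Periodicity moves an arbitrary point into the unit cube, where \<open>h0\<close>
    applies.\<close>
  have "?h y = ?h (\<chi> j. frac (y $ j))"
  proof (rule unit_periodic_cis_eq[OF per_comp_A[OF f(2)]])
    fix j
    have "2 * pi * frac (y $ j) = 2 * pi * y $ j - 2 * pi * of_int \<lfloor>y $ j\<rfloor>"
      by (simp add: frac_def algebra_simps)
    then show "cis (2 * pi * y $ j) = cis (2 * pi * (\<chi> j. frac (y $ j)) $ j)"
      by (simp add: complex_eq_iff cos_diff sin_diff)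
  qed
  also have "\<dots> = 0" by (rule h0) (simp add: mem_box_cart frac_lt_1 less_imp_le)
  finally show ?thesis by (simp add: y_def vector_matrix_mul_assoc A')
qed

text \<open>Translating along \<open>v\<close> does not change the mean, so differentiating under
  the integral gives 0. This is integration by parts without boundary terms.\<close>

lemma mean_derivative:
  assumes F: "\<And>x. (F has_derivative F' x) (at x)" and p: "per F"
    and c: "continuous_on UNIV (\<lambda>x. F' x v)"
  shows "mean (\<lambda>x. F' x v) = 0"
proof -
  have cF: "continuous_on UNIV F"
    using F by (meson has_derivative_continuous_on has_derivative_at_withinI)
  define G where "G s = integral (cbox 0 1) (\<lambda>x. F (x v* A + s *\<^sub>R v))" for s
  have G: "G s = mean F" for s
    using mean_shift[OF cF p, of "s *\<^sub>R v"] by (simp add: G_def mean_def)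
  have cont: "continuous_on S (\<lambda>z. snd z v* A + fst z *\<^sub>R v)" for S :: "(real \<times> (real^'n)) set"
    by (intro continuous_intros continuous_on_compose2[OF continuous_mult_A[of UNIV]]) auto
  have "((\<lambda>s. integral (cbox 0 1) (\<lambda>x. F (x v* A + s *\<^sub>R v))) has_real_derivative
      integral (cbox 0 1) (\<lambda>x. F' (x v* A + 0 *\<^sub>R v) v)) (at 0 within UNIV)"
  proof (rule leibniz_rule_field_derivative)
    show "((\<lambda>s. F (x v* A + s *\<^sub>R v)) has_real_derivative F' (x v* A + s *\<^sub>R v) v) (at s within UNIV)" for s x
    proof -
      have "((\<lambda>s. F (x v* A + s *\<^sub>R v)) has_derivative (\<lambda>h. F' (x v* A + s *\<^sub>R v) (h *\<^sub>R v))) (at s)"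
        by (rule has_derivative_compose[OF _ F]) (auto intro!: derivative_eq_intros)
      moreover have "F' y (h *\<^sub>R v) = F' y v * h" for h y
        using linear_cmul[OF has_derivative_linear[OF F[of y]]] by simp
      ultimately show ?thesis by (simp add: has_field_derivative_def)
    qed
    show "(\<lambda>x. F (x v* A + s *\<^sub>R v)) integrable_on cbox 0 1" for s
      by (intro integrable_continuous continuous_on_compose2[OF cF] continuous_intros continuous_mult_A) auto
    show "continuous_on (UNIV \<times> cbox 0 1) (\<lambda>(s, x). F' (x v* A + s *\<^sub>R v) v)"
      unfolding case_prod_beta by (rule continuous_on_compose2[OF c cont]) auto
  qed auto
  then have "(G has_real_derivative mean (\<lambda>x. F' x v)) (at 0)"
    by (simp add: G_def[abs_def] mean_def)
  moreover have "G = (\<lambda>s. mean F)" using G by (rule ext)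
  ultimately have "((\<lambda>s. mean F) has_real_derivative mean (\<lambda>x. F' x v)) (at 0)"
    by simp
  then show ?thesis using DERIV_unique[OF _ DERIV_const] by blast
qed

lemma per_ddir:
  assumes "smooth_fun f" "per f"
  shows "per (ddir v f)"
proof -
  have "(\<lambda>x. f (x + A $ j)) = f" for j using assms(2) by (auto simp: per_def)
  then have "ddir v f (x + A $ j) = ddir v f x" for j x
    using fun_cong[OF ddir_shift[OF assms(1), of v "A $ j"], of x] by simp
  then show ?thesis by (simp add: per_def)
qed

text \<open>Green's identity makes eigenfunctions for different eigenvalues orthogonal.\<close>
lemma mean_eigenfunction_cas:
  assumes f: "smooth_fun f" "per f" "\<And>x. lap f x = - t * f x"
    and l: "l \<in> dual" and ne: "4 * pi^2 * (norm l)^2 \<noteq> t"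
  shows "mean (\<lambda>x. f x * cas l x) = 0"
proof -
  note g = smooth_fun_cas[of l] and pg = per_cas[OF l]
  have green: "mean (\<lambda>x. f x * ddir e (ddir e (cas l)) x - cas l x * ddir e (ddir e f) x) = 0" for e
  proof -
    \<comment> \<open>The derivative of this Wronskian-like expression along \<open>e\<close> is the
      wanted integrand, since the products of first derivatives cancel.\<close>
    define F where "F x = f x * ddir e (cas l) x - cas l x * ddir e f x" for x
    define F' where "F' x v = (f x * ddir v (ddir e (cas l)) x + ddir v f x * ddir e (cas l) x)
       - (cas l x * ddir v (ddir e f) x + ddir v (cas l) x * ddir e f x)" for x v
    have "(F has_derivative F' x) (at x)" for x
      unfolding F_def F'_def
      by (intro has_derivative_diff has_derivative_mult smooth_fun_has_derivative smooth_fun_ddir f g)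
    moreover have "per F"
      using per_ddir[OF f(1,2), of e] per_ddir[OF g pg, of e] f(2) pg by (simp add: per_def F_def)
    moreover have "continuous_on UNIV (\<lambda>x. F' x e)"
      unfolding F'_def by (intro continuous_intros smooth_fun_continuous smooth_fun_ddir f g)
    ultimately have "mean (\<lambda>x. F' x e) = 0" by (rule mean_derivative)
    then show ?thesis by (simp add: F'_def algebra_simps)
  qed
  have "(t - 4 * pi^2 * (norm l)^2) * mean (\<lambda>x. f x * cas l x) = mean (\<lambda>x. f x * lap (cas l) x - cas l x * lap f x)"
    unfolding mean_cmult[symmetric] by (simp add: lap_cas f(3) algebra_simps)
  also have "\<dots> = mean (\<lambda>x. \<Sum>j\<in>UNIV. f x * ddir (axis j 1) (ddir (axis j 1) (cas l)) x
      - cas l x * ddir (axis j 1) (ddir (axis j 1) f) x)"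
    by (simp add: lap_def sum_subtractf sum_distrib_left)
  also have "\<dots> = 0"
    by (subst mean_sum) (intro continuous_on_diff continuous_on_mult smooth_fun_continuous
        smooth_fun_ddir f g, simp add: green)
  finally show ?thesis using ne by simp
qed

text \<open>\<open>A\<close> sends these frequencies injectively to integer vectors with bounded
  entries.\<close>

lemma finite_dual_norm: "finite {l \<in> dual. norm l \<le> R}"
proof -
  define N where "N = (\<Sum>j\<in>UNIV. norm (A $ j)) * R"
  have "finite ((*v) A ` {l \<in> dual. norm l \<le> R})"
  proof (rule finite_subset[OF _ finite_bounded_int_vecs[of N]], safe)
    fix l assume l: "l \<in> dual" "norm l \<le> R"
    then show "A *v l \<in> int_vecs" by (simp add: dual_def)
    fix j
    have "\<bar>(A *v l) $ j\<bar> \<le> norm (A $ j) * norm l"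
      by (simp add: matrix_vector_mul_component Cauchy_Schwarz_ineq2)
    also have "\<dots> \<le> N"
      unfolding N_def by (intro mult_mono member_le_sum l sum_nonneg) auto
    finally show "\<bar>(A *v l) $ j\<bar> \<le> N" .
  qed
  then show ?thesis by (rule finite_imageD) (auto simp: inj_on_def intro: inj_A)
qed

end

definition efun :: "(real^'n::finite) set \<Rightarrow> real \<Rightarrow> (real^'n \<Rightarrow> real) set" where
  "efun L t = {f. smooth_fun f \<and> (\<forall>v\<in>L. \<forall>x. f (x + v) = f x) \<and> (\<forall>x. lap f x = - t * f x)}"

text \<open>Indexed by the eigenvalue itself, as isospectrality ranges over all real
  \<open>t\<close>.\<close>

definition freq :: "(real^'n::finite) set \<Rightarrow> real \<Rightarrow> (real^'n) set" where
  "freq L t = {l \<in> dual_lattice L. 4 * pi^2 * (norm l)^2 = t}"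

lemma efun_subspace:
  fixes L :: "(real^'n::finite) set"
  shows "fv.subspace (efun L t)"
proof (rule fv.subspaceI)
  show "0 \<in> efun L t"
    using lap_cmult[OF smooth_fun_const, of 0 "0::real" "_::real^'n"]
    by (simp add: efun_def zero_fun_def smooth_fun_const)
  fix f g c assume f: "f \<in> efun L t" and g: "g \<in> efun L t"
  have fs: "smooth_fun f" and gs: "smooth_fun g" using f g by (auto simp: efun_def)
  have "lap (\<lambda>x. f x + g x) x = lap f x + lap g x" for x
    using lap_sum[of UNIV "\<lambda>b. if b then f else g" x] fs gs by (simp add: UNIV_bool add.commute)
  then show "f + g \<in> efun L t"
    using f g smooth_fun_add_cmult[OF fs gs, of 1 1] by (simp add: efun_def plus_fun_def algebra_simps)
  show "fscl c f \<in> efun L t"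
    using f smooth_fun_cmult[OF fs] lap_cmult[OF fs] by (simp add: efun_def fscl_def)
qed

lemma cas_efun: "l \<in> freq L t \<Longrightarrow> cas l \<in> efun L t"
  by (auto simp: efun_def freq_def dual_lattice_def smooth_fun_cas lap_cas cas_periodic)

context period_matrix
begin

context
  fixes L :: "(real^'n) set"
  assumes rows: "\<And>j. A $ j \<in> L"
begin

text \<open>The rows may generate a proper sublattice of \<open>L\<close>, so the inclusion can be
  strict.\<close>

lemma dual_lattice_subset: "dual_lattice L \<subseteq> dual"
  using rows by (auto simp: dual_lattice_def dual_def int_vecs_def matrix_vector_mul_component inner_commute)

lemma finite_freq: "finite (freq L t)"
proof (rule finite_subset[OF _ finite_dual_norm[of "sqrt (t / (4 * pi^2))"]], safe)
  fix l assume "l \<in> freq L t"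
  then have l: "l \<in> dual_lattice L" "t / (4 * pi^2) = (norm l)^2"
    by (auto simp: freq_def)
  show "l \<in> dual" using l(1) dual_lattice_subset by auto
  show "norm l \<le> sqrt (t / (4 * pi^2))" unfolding l(2) by simp
qed

lemma inj_on_cas: "inj_on cas (freq L t)"
proof (rule inj_onI, rule ccontr)
  fix a b assume ab: "a \<in> freq L t" "b \<in> freq L t" "cas a = cas b" "a \<noteq> b"
  then have d: "a \<in> dual" "b \<in> dual" using dual_lattice_subset by (auto simp: freq_def)
  show False using mean_cas_cas[OF d(1,1)] mean_cas_cas[OF d] ab by simp
qed

text \<open>Multiplying a vanishing combination by \<open>cas k\<close> and averaging isolates the
  coefficient of \<open>cas k\<close>.\<close>

lemma independent_cas: "fv.independent (cas ` freq L t)"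
proof (rule fv.independent_if_scalars_zero)
  show "finite (cas ` freq L t)" by (intro finite_imageI finite_freq)
  fix u f assume u: "(\<Sum>f\<in>cas ` freq L t. fscl (u f) f) = 0" and "f \<in> cas ` freq L t"
  then obtain k where k: "k \<in> freq L t" "f = cas k" by auto
  have d: "l \<in> dual" if "l \<in> freq L t" for l using that dual_lattice_subset by (auto simp: freq_def)
  have "(\<Sum>l\<in>freq L t. u (cas l) * cas l x) = 0" for x
    using fun_cong[OF u, of x]
    by (simp add: sum.reindex[OF inj_on_cas] sum_fscl_apply o_def)
  then have "(\<Sum>l\<in>freq L t. u (cas l) * (cas l x * cas k x)) = 0" for x
    by (simp add: mult.assoc[symmetric] sum_distrib_right[symmetric])
  then have "0 = mean (\<lambda>x. \<Sum>l\<in>freq L t. u (cas l) * (cas l x * cas k x))"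
    by (simp add: mean_def)
  also have "\<dots> = (\<Sum>l\<in>freq L t. if l = k then u (cas l) else 0)"
    by (subst mean_sum)
      (auto intro!: continuous_intros cas_continuous sum.cong simp: mean_cmult mean_cas_cas d k)
  also have "\<dots> = u (cas k)" using finite_freq k by simp
  finally show "u f = 0" using k by simp
qed

text \<open>Orthogonality of eigenfunctions leaves finitely many Fourier coefficients for the
  sublattice, and completeness makes the function equal to their sum. Periodicity under all of
  \<open>L\<close> then removes frequencies outside its dual.\<close>

lemma efun_eq_span: "efun L t = fv.span (cas ` freq L t)"
proof
  show "fv.span (cas ` freq L t) \<subseteq> efun L t"
    by (rule fv.span_minimal[OF _ efun_subspace]) (auto intro: cas_efun)
  show "efun L t \<subseteq> fv.span (cas ` freq L t)"
  proof
    fix f assume "f \<in> efun L t"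
    then have f: "smooth_fun f" "\<And>v x. v \<in> L \<Longrightarrow> f (x + v) = f x" "\<And>x. lap f x = - t * f x"
      by (auto simp: efun_def)
    have pf: "per f" using f(2) rows by (simp add: per_def)
    note cf = smooth_fun_continuous[OF f(1), of UNIV]
    \<comment> \<open>Frequencies of the right norm in the dual of the sublattice, possibly more
      than \<open>freq L t\<close>.\<close>
    define S where "S = {l \<in> dual. 4 * pi^2 * (norm l)^2 = t}"
    have finS: "finite S"
    proof (rule finite_subset[OF _ finite_dual_norm[of "sqrt (t / (4 * pi^2))"]], safe)
      fix l assume "l \<in> S"
      then have l: "l \<in> dual" "t / (4 * pi^2) = (norm l)^2" by (auto simp: S_def)
      show "l \<in> dual" by (rule l)
      show "norm l \<le> sqrt (t / (4 * pi^2))" unfolding l(2) by simp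
    qed
    define c where "c l = mean (\<lambda>x. f x * cas l x)" for l
    define g where "g x = (\<Sum>l\<in>S. c l * cas l x)" for x
    have cg: "continuous_on UNIV g"
      unfolding g_def by (intro continuous_intros cas_continuous)
    have "1 * f x + (-1) * g x = 0" for x
    proof (rule cas_complete)
      show "continuous_on UNIV (\<lambda>x. 1 * f x + (-1) * g x)"
        by (intro continuous_intros cf cg)
      have "per g" using per_cas by (simp add: per_def g_def S_def)
      then show "per (\<lambda>x. 1 * f x + (-1) * g x)" using pf by (simp add: per_def)
      fix l assume l: "l \<in> dual"
      have "mean (\<lambda>x. g x * cas l x) = mean (\<lambda>x. \<Sum>k\<in>S. c k * (cas k x * cas l x))"
        by (simp add: g_def sum_distrib_right mult.assoc)
      also have "\<dots> = (\<Sum>k\<in>S. if k = l then c k else 0)"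
        by (subst mean_sum)
          (auto intro!: continuous_intros cas_continuous sum.cong simp: mean_cmult mean_cas_cas l S_def)
      also have "\<dots> = (if l \<in> S then c l else 0)" using finS by simp
      also have "\<dots> = c l"
        using mean_eigenfunction_cas[OF f(1) pf f(3) l] l by (auto simp: S_def c_def)
      finally have gl: "mean (\<lambda>x. g x * cas l x) = c l" .
      have "mean (\<lambda>x. (1 * f x + (-1) * g x) * cas l x) =
        mean (\<lambda>x. 1 * (f x * cas l x) + (-1) * (g x * cas l x))"
        by (simp add: algebra_simps)
      also have "\<dots> = 0"
        by (subst mean_add_cmult) (auto intro!: continuous_intros cf cg cas_continuous simp: gl c_def)
      finally show "mean (\<lambda>x. (1 * f x + (-1) * g x) * cas l x) = 0" .
    qed
    then have fg: "f x = g x" for x by (simp add: eq_iff_diff_eq_0[of "f x"])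
    \<comment> \<open>Translation by a vector \<open>v\<close> of \<open>L\<close> with l . v not
      integral rotates the pair of coefficients at \<open>l\<close> and \<open>- l\<close> by a
      nontrivial angle, yet must fix it.\<close>
    have c0: "c l = 0" if l: "l \<in> S" "l \<notin> dual_lattice L" for l
    proof -
      have ld: "l \<in> dual" using l(1) by (simp add: S_def)
      obtain v where v: "v \<in> L" "l \<bullet> v \<notin> \<int>" using l(2) by (auto simp: dual_lattice_def)
      define C where "C = cos (2 * pi * (l \<bullet> v))"
      define D where "D = sin (2 * pi * (l \<bullet> v))"
      have C: "C \<noteq> 1"
      proof
        assume "C = 1"
        then obtain n :: int where "2 * pi * (l \<bullet> v) = of_int n * 2 * pi"
          unfolding C_def cos_one_2pi_int by blast
        then have "l \<bullet> v = of_int n" by simp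
        then show False using v(2) by simp
      qed
      have rot: "c m = cos (2 * pi * (m \<bullet> v)) * c m + sin (2 * pi * (m \<bullet> v)) * c (- m)"
        if m: "m \<in> dual" for m
      proof -
        have "c m = mean (\<lambda>x. f (x + v) * cas m (x + v))"
          unfolding c_def
          by (rule mean_shift[symmetric])
            (use pf per_cas[OF m] in \<open>auto intro!: continuous_intros cf cas_continuous simp: per_def\<close>)
        also have "\<dots> = mean (\<lambda>x. cos (2 * pi * (m \<bullet> v)) * (f x * cas m x) + sin (2 * pi * (m \<bullet> v)) * (f x * cas (- m) x))"
          by (simp add: f(2)[OF v(1)] cas_plus_right algebra_simps)
        also have "\<dots> = cos (2 * pi * (m \<bullet> v)) * c m + sin (2 * pi * (m \<bullet> v)) * c (- m)"
          unfolding c_def by (rule mean_add_cmult) (intro continuous_intros cf cas_continuous)+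
        finally show ?thesis .
      qed
      have 1: "(1 - C) * c l = D * c (- l)" "(1 - C) * c (- l) = - D * c l"
        using rot[OF ld] rot[OF dual_uminus[OF ld]] by (simp_all add: C_def D_def algebra_simps)
      \<comment> \<open>Eliminating \<open>c (- l)\<close> from the two equations leaves the
        determinant (1 - C)^2 + D^2 as factor; it is nonzero because C is not 1.\<close>
      have "(1 - C) * ((1 - C) * c l) = - (D * D) * c l"
        unfolding 1(1) mult.left_commute[of "1 - C" D] 1(2) by simp
      then have "((1 - C) * (1 - C) + D * D) * c l = 0" by (simp add: algebra_simps)
      moreover have "(1 - C) * (1 - C) + D * D \<noteq> 0"
        using C by (simp add: sum_squares_eq_zero_iff)
      ultimately show ?thesis by (metis mult_eq_0_iff)
    qed
    have "f x = (\<Sum>l\<in>freq L t. c l * cas l x)" for x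
      unfolding fg g_def
      by (rule sum.mono_neutral_right[OF finS])
        (use c0 dual_lattice_subset in \<open>auto simp: freq_def S_def\<close>)
    then have "f = (\<lambda>x. \<Sum>l\<in>freq L t. c l * cas l x)" by (rule ext)
    also have "\<dots> \<in> fv.span (cas ` freq L t)"
      by (intro fv_span_sum fv_span_cmult fv.span_base imageI)
    finally show "f \<in> fv.span (cas ` freq L t)" .
  qed
qed

end

end

section \<open>Alternating forms\<close>

lemma alt_multilinear_cong:
  "alt_multilinear p f \<Longrightarrow> (\<And>i. i < p \<Longrightarrow> vs i = ws i) \<Longrightarrow> f vs = f ws"
  unfolding alt_multilinear_def by blast

lemma alt_multilinear_linear:
  "alt_multilinear p f \<Longrightarrow> i < p \<Longrightarrow> linear (\<lambda>v. f (vs(i := v)))"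
  unfolding alt_multilinear_def by blast

lemma alt_multilinear_eq_0:
  "alt_multilinear p f \<Longrightarrow> i < p \<Longrightarrow> j < p \<Longrightarrow> i \<noteq> j \<Longrightarrow> vs i = vs j \<Longrightarrow> f vs = 0"
  unfolding alt_multilinear_def by blast

lemma alt_multilinear_cmult:
  assumes "alt_multilinear p f"
  shows "alt_multilinear p (\<lambda>vs. c * f vs)"
  unfolding alt_multilinear_def
proof (intro conjI allI impI)
  fix i vs assume "i < p"
  from linear_compose_scale_right[OF alt_multilinear_linear[OF assms this], of c vs]
  show "linear (\<lambda>v. c * f (vs(i := v)))" by simp
qed (use assms in \<open>auto simp: alt_multilinear_def\<close>)

lemma alt_multilinear_sum:
  fixes f :: "'k \<Rightarrow> (nat \<Rightarrow> real^'n::finite) \<Rightarrow> real"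
  assumes "\<And>k. k \<in> K \<Longrightarrow> alt_multilinear p (f k)"
  shows "alt_multilinear p (\<lambda>vs. \<Sum>k\<in>K. f k vs)"
  unfolding alt_multilinear_def
proof (intro conjI allI impI)
  fix vs ws :: "nat \<Rightarrow> real^'n" assume "\<forall>i<p. vs i = ws i"
  then show "(\<Sum>k\<in>K. f k vs) = (\<Sum>k\<in>K. f k ws)"
    by (intro sum.cong refl alt_multilinear_cong[OF assms]) auto
next
  fix i vs assume "i < p"
  then show "linear (\<lambda>v. \<Sum>k\<in>K. f k (vs(i := v)))"
    by (intro linear_compose_sum ballI alt_multilinear_linear[OF assms])
next
  fix i j and vs :: "nat \<Rightarrow> real^'n" assume "i < p" "j < p" "i \<noteq> j \<and> vs i = vs j"
  then show "(\<Sum>k\<in>K. f k vs) = 0"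
    by (intro sum.neutral ballI alt_multilinear_eq_0[OF assms, where i = i and j = j]) auto
qed

lemma alt_multilinear_diff:
  assumes "alt_multilinear p f" "alt_multilinear p g"
  shows "alt_multilinear p (\<lambda>vs. f vs - g vs)"
proof -
  have "alt_multilinear p (\<lambda>vs. \<Sum>b\<in>UNIV. (if b then f else (\<lambda>vs. (-1) * g vs)) vs)"
    by (rule alt_multilinear_sum) (simp add: assms alt_multilinear_cmult[of p g "-1", simplified])
  then show ?thesis by (simp add: UNIV_bool algebra_simps)
qed

lemma alt_multilinear_compose:
  fixes B :: "real^'m::finite^'n::finite"
  assumes "alt_multilinear p f"
  shows "alt_multilinear p (\<lambda>vs. f (\<lambda>i. B *v vs i))"
  unfolding alt_multilinear_def
proof (intro conjI allI impI)
  fix vs ws :: "nat \<Rightarrow> real^'m" assume "\<forall>i<p. vs i = ws i"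
  then show "f (\<lambda>i. B *v vs i) = f (\<lambda>i. B *v ws i)"
    by (intro alt_multilinear_cong[OF assms]) auto
next
  fix i and vs :: "nat \<Rightarrow> real^'m" assume "i < p"
  have "(\<lambda>v. f (\<lambda>j. B *v (vs(i := v)) j)) = (\<lambda>v. f ((\<lambda>j. B *v vs j)(i := v))) \<circ> (\<lambda>v. B *v v)"
    by (auto simp: fun_eq_iff intro!: arg_cong[of _ _ f])
  then show "linear (\<lambda>v. f (\<lambda>j. B *v (vs(i := v)) j))"
    using linear_compose[OF matrix_vector_mul_linear[of B] alt_multilinear_linear[OF assms \<open>i < p\<close>]] by simp
next
  fix i j and vs :: "nat \<Rightarrow> real^'m" assume "i < p" "j < p" "i \<noteq> j \<and> vs i = vs j"
  then show "f (\<lambda>i. B *v vs i) = 0"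
    by (intro alt_multilinear_eq_0[OF assms, of i j]) auto
qed

lemma alt_multilinear_scale:
  assumes f: "alt_multilinear p f"
  shows "f (\<lambda>j. c j *\<^sub>R vs j) = (\<Prod>j<p. c j) * f vs"
proof -
  have "q \<le> p \<Longrightarrow> f (\<lambda>j. if j < q then c j *\<^sub>R vs j else vs j) = (\<Prod>j<q. c j) * f vs" for q
  proof (induction q)
    case (Suc q)
    let ?w = "\<lambda>j. if j < q then c j *\<^sub>R vs j else vs j"
    have "(\<lambda>j. if j < Suc q then c j *\<^sub>R vs j else vs j) = ?w(q := c q *\<^sub>R vs q)"
      by (auto simp: fun_eq_iff)
    then have "f (\<lambda>j. if j < Suc q then c j *\<^sub>R vs j else vs j) = c q * f (?w(q := vs q))"
      using linear_cmul[OF alt_multilinear_linear[OF f, of q ?w]] Suc.prems by simp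
    also have "?w(q := vs q) = ?w" by (auto simp: fun_eq_iff)
    finally show ?case using Suc by simp
  qed simp
  from this[of p] show ?thesis
    using alt_multilinear_cong[OF f, of "\<lambda>j. if j < p then c j *\<^sub>R vs j else vs j" "\<lambda>j. c j *\<^sub>R vs j"]
    by simp
qed

text \<open>Expand the vanishing value at equal arguments \<open>vs a + vs b\<close> in positions
  \<open>a\<close> and \<open>b\<close>; only the two mixed terms survive.\<close>

lemma alt_multilinear_swap:
  assumes f: "alt_multilinear p f" and ab: "a < p" "b < p" "a \<noteq> b"
  shows "f (vs \<circ> Transposition.transpose a b) = - f vs"
proof -
  define g where "g x y = f (vs(a := x, b := y))" for x y
  have l2: "linear (g x)" for x
    using alt_multilinear_linear[OF f ab(2), of "vs(a := x)"] by (simp add: g_def[abs_def])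
  have l1: "linear (\<lambda>x. g x y)" for y
    using alt_multilinear_linear[OF f ab(1), of "vs(b := y)"]
    by (simp add: g_def[abs_def] fun_upd_twist[OF ab(3)])
  have d: "g x x = 0" for x
    unfolding g_def by (rule alt_multilinear_eq_0[OF f ab]) (use ab in auto)
  have "0 = g (vs a + vs b) (vs a + vs b)" by (simp add: d)
  also have "\<dots> = g (vs a) (vs b) + g (vs b) (vs a)"
    by (simp only: linear_add[OF l2] linear_add[OF l1]) (simp add: d)
  also have "g (vs a) (vs b) = f vs" by (simp add: g_def)
  also have "g (vs b) (vs a) = f (vs \<circ> Transposition.transpose a b)"
    unfolding g_def by (intro arg_cong[of _ _ f]) (auto simp: fun_eq_iff Transposition.transpose_def)
  finally show ?thesis by simp
qed

text \<open>Tracking only the vanishing avoids the sign of the permutation, and suffices for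
  uniqueness on basis tuples.\<close>

lemma alt_multilinear_permute_eq_0_iff:
  assumes f: "alt_multilinear p f" and q: "q permutes {..<p}"
  shows "f (vs \<circ> q) = 0 \<longleftrightarrow> f vs = 0"
  using finite_lessThan q
proof (induction q rule: permutes_rev_induct)
  case (swap a b q)
  then have "f ((vs \<circ> q) \<circ> Transposition.transpose a b) = - f (vs \<circ> q)"
    by (intro alt_multilinear_swap[OF f]) auto
  then have "f (vs \<circ> (q \<circ> Transposition.transpose a b)) = - f (vs \<circ> q)"
    by (simp only: comp_assoc)
  then show ?case using swap by (metis neg_equal_0_iff_equal)
qed (simp add: id_def o_def)

text \<open>The index type has no order, so increasing multi-indices are replaced by sets with an
  arbitrary fixed enumeration.\<close>

definition enum :: "'a set \<Rightarrow> nat \<Rightarrow> 'a" where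
  "enum J = (SOME h. bij_betw h {..<card J} J)"

lemma bij_betw_enum: "finite J \<Longrightarrow> bij_betw (enum J) {..<card J} J"
  unfolding enum_def
  using someI_ex[OF ex_bij_betw_nat_finite[of J]] by (simp add: lessThan_atLeast0)

text \<open>The rows of \<open>U\<close> form a basis of \<open>real^'n\<close>, in which \<open>v v* U'\<close> are the coordinates of \<open>v\<close>.\<close>
locale frame =
  fixes U U' :: "real^'n::finite^'n"
  assumes UU': "U ** U' = mat 1" and U'U: "U' ** U = mat 1"
begin

lemma coords_row: "U $ i v* U' = axis i 1"
proof -
  have "U $ i = axis i 1 v* U"
    using matrix_vector_mult_basis[of "transpose U" i] by (simp add: row_def)
  then show ?thesis by (simp add: vector_matrix_mul_assoc UU')
qed

lemma expand_row: "v = (\<Sum>i\<in>UNIV. (v v* U') $ i *\<^sub>R U $ i)"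
proof -
  have "v = (v v* U') v* U" by (simp add: vector_matrix_mul_assoc U'U)
  also have "\<dots> = (\<Sum>i\<in>UNIV. (v v* U') $ i *\<^sub>R U $ i)"
    by (simp add: vec_eq_iff vector_matrix_mult_def[of "v v* U'"] mult.commute)
  finally show ?thesis .
qed

definition basis_vecs :: "'n set \<Rightarrow> nat \<Rightarrow> real^'n" where
  "basis_vecs J j = U $ enum J j"

text \<open>The elementary alternating form dual to \<open>basis_vecs J\<close>, written as a minor.\<close>
definition basis_form :: "'n set \<Rightarrow> (nat \<Rightarrow> real^'n) \<Rightarrow> real" where
  "basis_form J vs = det (\<chi> i. if i \<in> J
     then vs (inv_into {..<card J} (enum J) i) v* U' else axis i 1)"

lemma alt_multilinear_basis_form: "alt_multilinear (card J) (basis_form J)"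
proof -
  have b: "bij_betw (enum J) {..<card J} J" by (rule bij_betw_enum) simp
  define pos where "pos = inv_into {..<card J} (enum J)"
  have pos: "pos i < card J" "enum J (pos i) = i" if "i \<in> J" for i
    using that b by (auto simp: pos_def bij_betw_inv_into_right)
      (metis bij_betw_def inv_into_into lessThan_iff)
  have pos_enum: "pos (enum J k) = k" "enum J k \<in> J" if "k < card J" for k
    using that b by (auto simp: pos_def bij_betw_inv_into_left bij_betwE)
  have bf: "basis_form J vs = det (\<chi> i. if i \<in> J then vs (pos i) v* U' else axis i 1)" for vs
    unfolding basis_form_def pos_def ..
  show ?thesis
    unfolding alt_multilinear_def
  proof (intro conjI allI impI)
    fix vs ws :: "nat \<Rightarrow> real^'n" assume "\<forall>i<card J. vs i = ws i"
    then show "basis_form J vs = basis_form J ws"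
      unfolding bf using pos(1) by (intro arg_cong[of _ _ "\<lambda>M. det (vec_lambda M)"] ext) simp
  next
    fix k vs assume k: "k < card J"
    define R where "R i = (if i \<in> J then vs (pos i) v* U' else axis i 1)" for i
    \<comment> \<open>Argument number \<open>k\<close> occurs only in row \<open>enum J k\<close>,
      so linearity in it is linearity of the determinant in one row.\<close>
    have upd: "basis_form J (vs(k := v)) = det (\<chi> i. if i = enum J k then v v* U' else R i)" for v
    proof -
      have "pos i = k \<longleftrightarrow> i = enum J k" if "i \<in> J" for i
        using pos(2)[OF that] pos_enum(1)[OF k] by auto
      then show ?thesis
        unfolding bf R_def using pos_enum(2)[OF k]
        by (intro arg_cong[of _ _ det]) (auto simp: vec_eq_iff)
    qed
    show "linear (\<lambda>v. basis_form J (vs(k := v)))"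
    proof (rule linearI)
      fix v w c
      show "basis_form J (vs(k := v + w)) = basis_form J (vs(k := v)) + basis_form J (vs(k := w))"
        unfolding upd vector_matrix_left_distrib by (rule det_row_add)
      show "basis_form J (vs(k := c *\<^sub>R v)) = c *\<^sub>R basis_form J (vs(k := v))"
      proof -
        have "(c *\<^sub>R v) v* U' = c *s (v v* U')"
          by (simp add: vec_eq_iff vector_matrix_mult_def sum_distrib_left mult_ac)
        then show ?thesis unfolding upd by (simp only: det_row_mul real_scaleR_def)
      qed
    qed
  next
    fix i j and vs :: "nat \<Rightarrow> real^'n" assume ij: "i < card J" "j < card J" "i \<noteq> j \<and> vs i = vs j"
    have "enum J i \<noteq> enum J j" using ij pos_enum(1) by metis
    then show "basis_form J vs = 0"
      unfolding bf
      by (rule det_identical_rows) (use ij pos_enum in \<open>simp add: row_def\<close>)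
  qed
qed

text \<open>For \<open>J = K\<close> the matrix is the identity. For distinct sets of equal size
  some \<open>k\<close> in \<open>K\<close> lies outside \<open>J\<close>; then row \<open>k\<close>
  and the row holding the coordinates of the \<open>k\<close>-th basis vector coincide.\<close>

lemma basis_form_basis_vecs:
  assumes "card J = card K"
  shows "basis_form J (basis_vecs K) = (if J = K then 1 else 0)"
proof -
  have b: "bij_betw (enum J) {..<card J} J" and bK: "bij_betw (enum K) {..<card K} K"
    by (rule bij_betw_enum, simp)+
  show ?thesis
  proof (cases "J = K")
    case True
    have "(\<chi> i. if i \<in> J then basis_vecs J (inv_into {..<card J} (enum J) i) v* U' else axis i 1) = mat 1"
      using b
      by (auto simp: vec_eq_iff basis_vecs_def bij_betw_inv_into_right coords_row axis_def mat_def)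
    then have "basis_form J (basis_vecs J) = 1" unfolding basis_form_def by (simp only: det_I)
    then show ?thesis using True by simp
  next
    case False
    then have "\<not> K \<subseteq> J" using card_subset_eq[of J K] assms by auto
    then obtain k where k: "k \<in> K" "k \<notin> J" by auto
    then have "k \<in> enum K ` {..<card K}" using bK by (simp add: bij_betw_def)
    then obtain m where m: "m < card K" "enum K m = k" by auto
    define i where "i = enum J m"
    have i: "i \<in> J" "inv_into {..<card J} (enum J) i = m"
      using m b assms by (auto simp: i_def bij_betw_inv_into_left bij_betwE)
    have "basis_form J (basis_vecs K) = 0"
      unfolding basis_form_def
      by (rule det_identical_rows[of i k])
        (use i k m in \<open>auto simp: row_def basis_vecs_def coords_row vec_eq_iff\<close>)
    then show ?thesis using False by simp
  qed
qed

text \<open>A repeated index kills the form; otherwise the tuple is a rearrangement of the basis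
  tuple of its index set.\<close>

lemma alt_multilinear_eq_0_rows:
  assumes f: "alt_multilinear p f" and z: "\<And>J. card J = p \<Longrightarrow> f (basis_vecs J) = 0"
  shows "f (\<lambda>j. U $ w j) = 0"
proof (cases "inj_on w {..<p}")
  case False
  then obtain i j where "i < p" "j < p" "i \<noteq> j" "w i = w j" by (auto simp: inj_on_def)
  then show ?thesis by (intro alt_multilinear_eq_0[OF f, of i j]) auto
next
  case True
  define J where "J = w ` {..<p}"
  have cJ: "card J = p" using True by (simp add: J_def card_image)
  have bw: "bij_betw w {..<p} J" using True by (simp add: J_def bij_betw_def)
  have be: "bij_betw (enum J) {..<p} J" using bij_betw_enum[of J] cJ by simp
  \<comment> \<open>Extended by the identity, because \<open>permutes\<close> prescribes the values
    outside the set.\<close>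
  define q where "q j = (if j < p then inv_into {..<p} w (enum J j) else j)" for j
  have "bij_betw (inv_into {..<p} w \<circ> enum J) {..<p} {..<p}"
    by (rule bij_betw_trans[OF be bij_betw_inv_into[OF bw]])
  then have "bij_betw q {..<p} {..<p}" by (rule bij_betw_cong[THEN iffD1, rotated]) (simp add: q_def)
  then have q: "q permutes {..<p}" by (rule bij_imp_permutes) (simp add: q_def)
  have "w (q j) = enum J j" if "j < p" for j
    using that bij_betw_inv_into_right[OF bw] be by (auto simp: q_def bij_betwE)
  then have "f ((\<lambda>j. U $ w j) \<circ> q) = f (basis_vecs J)"
    by (intro alt_multilinear_cong[OF f]) (simp add: basis_vecs_def)
  then show ?thesis using alt_multilinear_permute_eq_0_iff[OF f q] z[OF cJ] by simp
qed

lemma alt_multilinear_eq_0_basis: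
  assumes f: "alt_multilinear p f" and z: "\<And>J. card J = p \<Longrightarrow> f (basis_vecs J) = 0"
  shows "f vs = 0"
proof -
  \<comment> \<open>Here \<open>q\<close> counts the leading arguments that may still be arbitrary;
    each step expands the last of them in the basis.\<close>
  have "q \<le> p \<Longrightarrow> (\<And>i. q \<le> i \<Longrightarrow> i < p \<Longrightarrow> \<exists>k. vs i = U $ k) \<Longrightarrow> f vs = 0" for q vs
  proof (induction q arbitrary: vs)
    case 0
    then have "\<forall>i. \<exists>k. i < p \<longrightarrow> vs i = U $ k" by auto
    then obtain w where "\<And>i. i < p \<Longrightarrow> vs i = U $ w i" by metis
    then have "f vs = f (\<lambda>i. U $ w i)" by (intro alt_multilinear_cong[OF f])
    then show ?case using alt_multilinear_eq_0_rows[OF f z] by simp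
  next
    case (Suc q)
    have l: "linear (\<lambda>v. f (vs(q := v)))" using alt_multilinear_linear[OF f] Suc.prems by simp
    have "f vs = f (vs(q := \<Sum>i\<in>UNIV. (vs q v* U') $ i *\<^sub>R U $ i))"
      by (simp add: expand_row[of "vs q", symmetric])
    also have "\<dots> = (\<Sum>i\<in>UNIV. (vs q v* U') $ i * f (vs(q := U $ i)))"
      by (simp add: linear_sum[OF l] linear_cmul[OF l])
    also have "\<dots> = 0"
    proof (intro sum.neutral ballI)
      fix i
      have "f (vs(q := U $ i)) = 0"
        by (rule Suc.IH) (use Suc.prems in \<open>auto simp: Suc_le_eq\<close>)
      then show "(vs q v* U') $ i * f (vs(q := U $ i)) = 0" by simp
    qed
    finally show ?case .
  qed
  from this[of p vs] show ?thesis by simp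
qed

lemma alt_multilinear_expand:
  assumes f: "alt_multilinear p f"
  shows "f vs = (\<Sum>J | card J = p. f (basis_vecs J) * basis_form J vs)"
proof -
  have "f vs - (\<Sum>J | card J = p. f (basis_vecs J) * basis_form J vs) = 0"
  proof (rule alt_multilinear_eq_0_basis)
    show "alt_multilinear p (\<lambda>vs. f vs - (\<Sum>J | card J = p. f (basis_vecs J) * basis_form J vs))"
      by (intro alt_multilinear_diff f alt_multilinear_sum alt_multilinear_cmult)
        (use alt_multilinear_basis_form in auto)
    fix K :: "'n set" assume K: "card K = p"
    have "(\<Sum>J | card J = p. f (basis_vecs J) * basis_form J (basis_vecs K)) =
      (\<Sum>J | card J = p. if J = K then f (basis_vecs J) else 0)"
      by (rule sum.cong) (auto simp: basis_form_basis_vecs K)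
    also have "\<dots> = f (basis_vecs K)" using K by simp
    finally show "f (basis_vecs K) - (\<Sum>J | card J = p. f (basis_vecs J) * basis_form J (basis_vecs K)) = 0"
      by simp
  qed
  then show ?thesis by simp
qed

end

section \<open>Bieberbach groups with holonomy of exponent two\<close>

text \<open>Serves twice: to pick a period matrix from the translation lattice and to pick a frame
  of common eigenvectors.\<close>

lemma span_UNIV_invertible_rows:
  fixes S :: "(real^'n::finite) set"
  assumes "span S = UNIV"
  shows "\<exists>A :: real^'n^'n. invertible A \<and> (\<forall>j. A $ j \<in> S)"
proof -
  obtain B where B: "B \<subseteq> S" "independent B" "S \<subseteq> span B" "card B = dim S"
    using basis_exists[of S] by blast
  have sB: "span B = UNIV"
    using assms B(3) span_minimal[OF B(3) subspace_span] by auto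
  have "card B = CARD('n)"
    using B(4) dim_span[of S] assms by (simp add: dim_UNIV)
  moreover have "finite B" using B(2) independent_bound by blast
  ultimately obtain b :: "'n \<Rightarrow> real^'n" where b: "bij_betw b UNIV B"
    using finite_same_card_bij[of "UNIV :: 'n set" B] by auto
  define A where "A = (\<chi> j. b j)"
  have "rows A = B"
    using bij_betw_imp_surj_on[OF b] by (auto simp: rows_def row_def A_def)
  then have "invertible A"
    using matrix_left_invertible_span_rows[of A] sB by (auto simp: invertible_left_inverse)
  moreover have "A $ j \<in> S" for j using b B(1) by (auto simp: A_def bij_betw_def)
  ultimately show ?thesis by blast
qed

text \<open>Split each vector as \<open>v = (v + Bv)/2 + (v - Bv)/2\<close>, one involution \<open>B\<close> at a time.\<close>
lemma span_common_eigenvectors: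
  fixes F :: "(real^'n::finite^'n) set"
  assumes "finite F" "\<And>B. B \<in> F \<Longrightarrow> B ** B = mat 1" "\<And>B C. B \<in> F \<Longrightarrow> C \<in> F \<Longrightarrow> B ** C = C ** B"
  shows "span {v. \<forall>B\<in>F. B *v v = v \<or> B *v v = - v} = UNIV"
  using assms
proof (induction F rule: finite_induct)
  case (insert B F)
  define T where "T = {v. \<forall>B\<in>F. B *v v = v \<or> B *v v = - v}"
  define T' where "T' = {v. \<forall>C\<in>insert B F. C *v v = v \<or> C *v v = - v}"
  have BB: "B *v (B *v v) = v" for v
    using insert.prems(1)[of B] by (simp add: matrix_vector_mul_assoc)
  have "T \<subseteq> span T'"
  proof
    fix v assume v: "v \<in> T"
    have mem: "v + s *\<^sub>R (B *v v) \<in> T'" if s: "s = 1 \<or> s = - 1" for s :: real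
    proof -
      have "B *v (v + s *\<^sub>R (B *v v)) = s *\<^sub>R (v + s *\<^sub>R (B *v v))"
        using s by (auto simp: matrix_vector_right_distrib matrix_vector_mult_scaleR BB
            matrix_vector_mult_diff_distrib)
      moreover have "C *v (v + s *\<^sub>R (B *v v)) = v + s *\<^sub>R (B *v v) \<or>
          C *v (v + s *\<^sub>R (B *v v)) = - (v + s *\<^sub>R (B *v v))" if C: "C \<in> F" for C
      proof -
        have "C *v (B *v v) = B *v (C *v v)"
          using insert.prems(2)[of C B] C by (simp add: matrix_vector_mul_assoc)
        then have "C *v (v + s *\<^sub>R (B *v v)) = C *v v + s *\<^sub>R (B *v (C *v v))"
          by (simp add: matrix_vector_right_distrib matrix_vector_mult_scaleR)
        moreover have "C *v v = v \<or> C *v v = - v" using v C by (auto simp: T_def)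
        moreover have "B *v (- v) = - (B *v v)"
          using linear_neg[OF matrix_vector_mul_linear, of B v] .
        ultimately show ?thesis by auto
      qed
      ultimately show ?thesis using s by (auto simp: T'_def)
    qed
    have "v = (1/2) *\<^sub>R (v + v)" by simp
    also have "\<dots> = (1/2) *\<^sub>R (v + 1 *\<^sub>R (B *v v)) + (1/2) *\<^sub>R (v + (- 1) *\<^sub>R (B *v v))"
      by (simp only: scaleR_add_right[symmetric]) simp
    also have "\<dots> \<in> span T'"
      by (intro span_add span_mul span_base mem) auto
    finally show "v \<in> span T'" .
  qed
  moreover have "span T = UNIV" unfolding T_def using insert by (intro insert.IH) auto
  ultimately have "span T' = UNIV" using span_minimal[OF _ subspace_span, of T T'] by auto
  then show ?case by (simp add: T'_def)
qed simp

section \<open>The holonomy as a finite group of commuting matrices\<close>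

lemma carrier_Z2_pow: "carrier (Z2_pow k) = (\<Pi>\<^sub>E i\<in>{..<k}. {0..<2})"
  by (simp add: Z2_pow_def carrier_integer_mod_group)

lemma card_Z2_pow: "card (carrier (Z2_pow k)) = 2 ^ k"
  by (simp add: carrier_Z2_pow card_PiE)

lemma mult_Z2_pow: "x \<otimes>\<^bsub>Z2_pow k\<^esub> y = (\<lambda>i\<in>{..<k}. (x i + y i) mod 2)"
  by (simp add: Z2_pow_def product_group_def integer_mod_group_def)

locale bieberbach_Z2 =
  fixes G :: "'n::finite isom set" and k :: nat
  assumes bieberbach: "bieberbach G" and holonomy: "holonomy G \<cong> Z2_pow k"
begin

lemma orth: "g \<in> G \<Longrightarrow> orthogonal_matrix (fst g)"
  and one_mem: "iso_one \<in> G"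
  and mult_mem: "g \<in> G \<Longrightarrow> h \<in> G \<Longrightarrow> iso_mult g h \<in> G"
  and inv_mem: "g \<in> G \<Longrightarrow> iso_inv g \<in> G"
  and cocompact: "\<exists>K. compact K \<and> (\<forall>x. \<exists>g\<in>G. iso_act g x \<in> K)"
  and torsion_free: "g \<in> G \<Longrightarrow> m > 0 \<Longrightarrow> iso_pow g m = iso_one \<Longrightarrow> g = iso_one"
  using bieberbach by (simp_all add: bieberbach_def)

lemma orth_mult:
  assumes "g \<in> G"
  shows "transpose (fst g) ** fst g = mat 1" "fst g ** transpose (fst g) = mat 1"
  using orth[OF assms] by (simp_all add: orthogonal_matrix_def)

lemma orth_inner:
  assumes "g \<in> G"
  shows "(fst g *v x) \<bullet> (fst g *v y) = x \<bullet> y"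
proof -
  have "(fst g *v x) v* fst g = (transpose (fst g) ** fst g) *v x"
    by (simp add: matrix_vector_mul_assoc[symmetric])
  then show ?thesis
    using dot_lmul_matrix[of "fst g *v x" "fst g" y] orth_mult[OF assms] by simp
qed

lemma mult_inv_cancel_right:
  assumes "h \<in> G"
  shows "iso_mult (iso_mult g (iso_inv h)) h = g"
proof -
  have "(fst g ** transpose (fst h)) ** fst h = fst g"
    using orth_mult[OF assms] by (simp add: matrix_mul_assoc[symmetric])
  moreover have "fst g *v (- (transpose (fst h) *v snd h)) = - ((fst g ** transpose (fst h)) *v snd h)"
    using linear_neg[OF matrix_vector_mul_linear, of "fst g" "transpose (fst h) *v snd h"]
    by (simp add: matrix_vector_mul_assoc del: transpose_matrix_vector)
  ultimately show ?thesis
    by (simp add: iso_mult_def iso_inv_def prod_eq_iff del: transpose_matrix_vector)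
qed

lemma mult_inv_cancel_left:
  assumes "h \<in> G"
  shows "iso_mult h (iso_mult (iso_inv h) g) = g"
proof -
  have "fst h ** (transpose (fst h) ** fst g) = fst g"
    using orth_mult[OF assms] by (simp add: matrix_mul_assoc)
  moreover have "fst h *v (transpose (fst h) *v x - transpose (fst h) *v y) = x - y" for x y
    using orth_mult[OF assms]
    by (simp add: matrix_vector_mult_diff_distrib matrix_vector_mul_assoc del: transpose_matrix_vector)
  ultimately show ?thesis
    by (simp add: iso_mult_def iso_inv_def prod_eq_iff del: transpose_matrix_vector)
qed

definition linear_parts :: "(real^'n^'n) set" where
  "linear_parts = fst ` G"

text \<open>These are the cosets of the translation subgroup, so holonomy elements are identified
  with linear parts.\<close>

definition fibre :: "real^'n^'n \<Rightarrow> 'n isom set" where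
  "fibre B = {g \<in> G. fst g = B}"

lemma fst_iso_mult: "fst (iso_mult g h) = fst g ** fst h"
  by (simp add: iso_mult_def)

lemma fst_iso_inv: "fst (iso_inv g) = transpose (fst g)"
  by (simp add: iso_inv_def)

lemma fibre_eq_iff: "A \<in> linear_parts \<Longrightarrow> fibre A = fibre B \<longleftrightarrow> A = B"
  by (auto simp: fibre_def linear_parts_def)

lemma rcoset_eq_fibre:
  assumes "g \<in> G"
  shows "transl_subgroup G #>\<^bsub>isom_group G\<^esub> g = fibre (fst g)"
proof
  show "transl_subgroup G #>\<^bsub>isom_group G\<^esub> g \<subseteq> fibre (fst g)"
  proof
    fix h assume "h \<in> transl_subgroup G #>\<^bsub>isom_group G\<^esub> g"
    then obtain t where "t \<in> transl_subgroup G" "h = iso_mult t g"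
      by (auto simp: r_coset_def isom_group_def)
    then show "h \<in> fibre (fst g)"
      using mult_mem[of t g] assms by (simp add: transl_subgroup_def fibre_def fst_iso_mult)
  qed
  show "fibre (fst g) \<subseteq> transl_subgroup G #>\<^bsub>isom_group G\<^esub> g"
  proof
    fix h assume h: "h \<in> fibre (fst g)"
    have "iso_mult h (iso_inv g) \<in> transl_subgroup G"
      using h assms orth_mult[OF assms]
        mult_mem[OF _ inv_mem[OF assms], of h]
      by (simp add: transl_subgroup_def fibre_def fst_iso_mult fst_iso_inv)
    moreover have "h = iso_mult (iso_mult h (iso_inv g)) g"
      using mult_inv_cancel_right[OF assms] by simp
    ultimately show "h \<in> transl_subgroup G #>\<^bsub>isom_group G\<^esub> g"
      by (auto simp: r_coset_def isom_group_def)
  qed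
qed

lemma carrier_holonomy: "carrier (holonomy G) = fibre ` linear_parts"
proof -
  have "carrier (holonomy G) = (\<lambda>g. transl_subgroup G #>\<^bsub>isom_group G\<^esub> g) ` G"
    by (auto simp: holonomy_def FactGroup_def RCOSETS_def isom_group_def)
  also have "\<dots> = (\<lambda>g. fibre (fst g)) ` G"
    by (intro image_cong refl rcoset_eq_fibre)
  finally show ?thesis by (simp add: linear_parts_def image_image)
qed

lemma linear_parts_mult:
  assumes "A \<in> linear_parts" "B \<in> linear_parts"
  shows "A ** B \<in> linear_parts"
proof -
  obtain g h where "g \<in> G" "h \<in> G" "A = fst g" "B = fst h"
    using assms unfolding linear_parts_def by blast
  then show ?thesis
    using imageI[OF mult_mem, of g h fst] by (simp add: linear_parts_def fst_iso_mult)
qed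

lemma linear_parts_one: "mat 1 \<in> linear_parts"
  using one_mem by (force simp: linear_parts_def iso_one_def)

lemma mult_holonomy:
  assumes "A \<in> linear_parts" "B \<in> linear_parts"
  shows "fibre A \<otimes>\<^bsub>holonomy G\<^esub> fibre B = fibre (A ** B)"
proof -
  have "fibre A \<otimes>\<^bsub>holonomy G\<^esub> fibre B = (\<Union>g\<in>fibre A. \<Union>h\<in>fibre B. {iso_mult g h})"
    by (simp add: holonomy_def FactGroup_def set_mult_def isom_group_def)
  also have "\<dots> = fibre (A ** B)"
  proof
    show "(\<Union>g\<in>fibre A. \<Union>h\<in>fibre B. {iso_mult g h}) \<subseteq> fibre (A ** B)"
      using mult_mem by (auto simp: fibre_def fst_iso_mult)
    show "fibre (A ** B) \<subseteq> (\<Union>g\<in>fibre A. \<Union>h\<in>fibre B. {iso_mult g h})"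
    proof
      fix h assume h: "h \<in> fibre (A ** B)"
      obtain g where g: "g \<in> G" "fst g = A" using assms(1) by (auto simp: linear_parts_def)
      have "iso_mult (iso_inv g) h \<in> fibre B"
        using h g mult_mem[OF inv_mem[OF g(1)]] orth_mult[OF g(1)]
        by (simp add: fibre_def fst_iso_mult fst_iso_inv matrix_mul_assoc)
      moreover have "h = iso_mult g (iso_mult (iso_inv g) h)"
        using mult_inv_cancel_left[OF g(1)] by simp
      ultimately show "h \<in> (\<Union>g\<in>fibre A. \<Union>h\<in>fibre B. {iso_mult g h})"
        using g unfolding fibre_def by blast
    qed
  qed
  finally show ?thesis .
qed

lemma obtain_iso: obtains \<phi> where "\<phi> \<in> iso (holonomy G) (Z2_pow k)"
  using holonomy by (auto simp: is_iso_def)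

lemma card_linear_parts: "card linear_parts = 2 ^ k"
proof -
  obtain \<phi> where "\<phi> \<in> iso (holonomy G) (Z2_pow k)" by (rule obtain_iso)
  then have "card (carrier (holonomy G)) = 2 ^ k"
    using bij_betw_same_card[of \<phi>] card_Z2_pow by (auto simp: iso_def)
  moreover have "inj_on fibre linear_parts" using fibre_eq_iff by (auto simp: inj_on_def)
  ultimately show ?thesis by (simp add: carrier_holonomy card_image)
qed

text \<open>An infinite set has \<open>card\<close> 0, so the positive value 2^k forces
  finiteness.\<close>

lemma finite_linear_parts: "finite linear_parts"
  by (rule card_ge_0_finite) (simp add: card_linear_parts)

text \<open>Both laws are pulled back along the injective homomorphism from \<open>Z2_pow k\<close>,
  where addition is commutative and doubling gives 0 modulo 2.\<close>

lemma
  assumes A: "A \<in> linear_parts" and B: "B \<in> linear_parts"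
  shows linear_parts_commute: "A ** B = B ** A"
    and linear_parts_square: "A ** A = mat 1"
proof -
  obtain \<phi> where \<phi>: "\<phi> \<in> iso (holonomy G) (Z2_pow k)" by (rule obtain_iso)
  have inj: "inj_on \<phi> (fibre ` linear_parts)"
    using \<phi> by (auto simp: iso_def bij_betw_def carrier_holonomy)
  have mult: "\<phi> (fibre (X ** Y)) = (\<lambda>i\<in>{..<k}. (\<phi> (fibre X) i + \<phi> (fibre Y) i) mod 2)"
    if "X \<in> linear_parts" "Y \<in> linear_parts" for X Y
    using \<phi> that unfolding mult_Z2_pow[symmetric] mult_holonomy[OF that, symmetric]
    by (intro hom_mult[of _ "holonomy G"]) (auto simp: iso_def carrier_holonomy)
  have eqI: "X = Y" if "\<phi> (fibre X) = \<phi> (fibre Y)" "X \<in> linear_parts" "Y \<in> linear_parts" for X Y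
    using inj_onD[OF inj that(1)] that(2,3) fibre_eq_iff[OF that(2)] by auto
  show "A ** B = B ** A"
    by (rule eqI) (auto simp: mult A B linear_parts_mult add.commute)
  have dbl: "(\<lambda>i\<in>{..<k}. (f i + f i) mod 2) = (\<lambda>i\<in>{..<k}. 0)" for f :: "nat \<Rightarrow> int"
    by (auto simp: fun_eq_iff)
  \<comment> \<open>Comparison with the square of \<open>mat 1\<close> takes the place of computing
    the image of the neutral element.\<close>
  have "\<phi> (fibre (A ** A)) = \<phi> (fibre (mat 1 ** mat 1))"
    unfolding mult[OF A A] mult[OF linear_parts_one linear_parts_one] dbl ..
  then show "A ** A = mat 1"
    by (intro eqI) (auto simp: linear_parts_mult linear_parts_one A)
qed

text \<open>An isometry x -> b - x is an involution, hence torsion, whatever the translation part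
  b.\<close>

lemma uminus_one_notin_linear_parts: "- mat 1 \<notin> linear_parts"
proof
  assume "- mat 1 \<in> linear_parts"
  then obtain b where g: "(- mat 1, b) \<in> G" by (auto simp: linear_parts_def)
  have "(- C) *v x = - (C *v x)" for C :: "real^'n^'n" and x
    by (simp add: vec_eq_iff matrix_vector_mult_def sum_negf)
  then have neg: "(- mat 1 :: real^'n^'n) *v x = - x" for x by simp
  have "(- mat 1 :: real^'n^'n) ** - mat 1 = mat 1"
    unfolding matrix_eq by (simp add: matrix_vector_mul_assoc[symmetric] neg)
  then have "iso_pow (- mat 1, b) 2 = iso_one"
    by (simp add: iso_pow_def iso_mult_def iso_one_def numeral_2_eq_2 neg)
  from torsion_free[OF g _ this] have e: "(- mat 1 :: real^'n^'n) = mat 1"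
    by (simp add: iso_one_def)
  have "(- mat 1 :: real^'n^'n) $ i $ i = mat 1 $ i $ i" for i by (simp only: e)
  then show False by (simp add: mat_def)
qed

text \<open>Conjugating the translation by \<open>v\<close> with \<open>g\<close> gives the
  translation by the image of \<open>v\<close> under the linear part.\<close>

lemma transl_lattice_conj:
  assumes "g \<in> G" "v \<in> transl_lattice G"
  shows "fst g *v v \<in> transl_lattice G"
proof -
  have "iso_mult (iso_mult g (mat 1, v)) (iso_inv g) \<in> G"
    using assms by (intro mult_mem inv_mem) (auto simp: transl_lattice_def)
  moreover have "iso_mult (iso_mult g (mat 1, v)) (iso_inv g) = (mat 1, fst g *v v)"
  proof -
    have "fst g *v (- (transpose (fst g) *v snd g)) = - snd g"
      using linear_neg[OF matrix_vector_mul_linear, of "fst g" "transpose (fst g) *v snd g"]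
        orth_mult[OF assms(1)]
      by (simp add: matrix_vector_mul_assoc del: transpose_matrix_vector)
    then show ?thesis
      using orth_mult[OF assms(1)] by (simp add: iso_mult_def iso_inv_def del: transpose_matrix_vector)
  qed
  ultimately show ?thesis by (simp add: transl_lattice_def)
qed

lemma same_linear_part:
  assumes "g \<in> G" "h \<in> G" "fst g = fst h"
  obtains v where "v \<in> transl_lattice G" "\<And>x. iso_act g x = iso_act h (x + v)"
proof -
  define v where "v = transpose (fst h) *v (snd g - snd h)"
  have "iso_mult (iso_inv h) g = (mat 1, v)"
    using orth_mult[OF assms(2)] assms(3)
    by (simp add: iso_mult_def iso_inv_def v_def matrix_vector_mult_diff_distrib del: transpose_matrix_vector)
  then have "v \<in> transl_lattice G"
    using mult_mem[OF inv_mem[OF assms(2)] assms(1)] by (simp add: transl_lattice_def)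
  moreover have "fst h *v v = snd g - snd h"
    using orth_mult[OF assms(2)] by (simp add: v_def matrix_vector_mul_assoc del: transpose_matrix_vector)
  then have "iso_act g x = iso_act h (x + v)" for x
    using assms(3) by (simp add: iso_act_def matrix_vector_right_distrib)
  ultimately show ?thesis by (rule that)
qed

text \<open>Cocompactness passes from \<open>G\<close> to its translations because the linear parts
  are finite in number: an element bringing \<open>x\<close> into the compact set differs from a
  fixed representative by a lattice translation.\<close>

lemma transl_lattice_cocompact: "\<exists>R. \<forall>x. \<exists>v\<in>transl_lattice G. norm (x + v) \<le> R"
proof -
  obtain K where K: "compact K" "\<And>x. \<exists>g\<in>G. iso_act g x \<in> K" using cocompact by blast
  obtain r where r: "\<And>y. y \<in> K \<Longrightarrow> norm y \<le> r"
    using compact_imp_bounded[OF K(1)] by (auto simp: bounded_iff)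
  obtain rep where rep: "\<And>B. B \<in> linear_parts \<Longrightarrow> rep B \<in> G \<and> fst (rep B) = B"
  proof -
    have "\<forall>B\<in>linear_parts. \<exists>g. g \<in> G \<and> fst g = B" unfolding linear_parts_def by blast
    from bchoice[OF this] show ?thesis using that by blast
  qed
  \<comment> \<open>The sum over all representatives bounds the translation part of whichever one
    occurs.\<close>
  define R where "R = r + (\<Sum>B\<in>linear_parts. norm (snd (rep B)))"
  have "\<exists>v\<in>transl_lattice G. norm (x + v) \<le> R" for x
  proof -
    obtain g where g: "g \<in> G" "iso_act g x \<in> K" using K(2) by blast
    define h where "h = rep (fst g)"
    have B: "fst g \<in> linear_parts" using g by (auto simp: linear_parts_def)
    have h: "h \<in> G" "fst h = fst g" using rep[OF B] by (auto simp: h_def)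
    obtain v where v: "v \<in> transl_lattice G" "\<And>x. iso_act g x = iso_act h (x + v)"
      using same_linear_part[OF g(1) h(1) h(2)[symmetric]] by metis
    have "norm (x + v) = norm (fst h *v (x + v))"
      using orth_inner[OF h(1)] by (simp add: norm_eq_sqrt_inner)
    also have "\<dots> \<le> norm (iso_act h (x + v)) + norm (snd h)"
      unfolding iso_act_def using norm_triangle_ineq4[of "fst h *v (x + v) + snd h" "snd h"] by simp
    also have "\<dots> \<le> R"
      unfolding R_def using r[OF g(2)] v(2)
      by (intro add_mono) (auto simp: h_def intro!: member_le_sum B finite_linear_parts)
    finally show ?thesis using v(1) by blast
  qed
  then show ?thesis by blast
qed

lemma span_transl_lattice: "span (transl_lattice G) = UNIV"
proof (rule ccontr)
  assume "span (transl_lattice G) \<noteq> UNIV"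
  then obtain a where a: "a \<noteq> 0" "span (transl_lattice G) \<subseteq> {x. a \<bullet> x = 0}"
    using span_not_univ_subset_hyperplane by blast
  obtain R where R: "\<And>x. \<exists>v\<in>transl_lattice G. norm (x + v) \<le> R"
    using transl_lattice_cocompact by blast
  \<comment> \<open>Lattice translations do not change the component along \<open>a\<close>, and
    this point has component larger than R there.\<close>
  define x where "x = ((\<bar>R\<bar> + 1) / norm a) *\<^sub>R a"
  obtain v where v: "v \<in> transl_lattice G" "norm (x + v) \<le> R" using R by blast
  have "a \<bullet> v = 0" using a(2) v(1) span_base by blast
  then have "a \<bullet> (x + v) = (\<bar>R\<bar> + 1) * norm a"
    using a(1) by (simp add: x_def inner_add_right dot_square_norm power2_eq_square)
  moreover have "a \<bullet> (x + v) \<le> norm a * norm (x + v)"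
    by (rule norm_cauchy_schwarz)
  ultimately have "norm a * (\<bar>R\<bar> + 1) \<le> norm a * norm (x + v)" by (simp add: mult.commute)
  then have "\<bar>R\<bar> + 1 \<le> norm (x + v)" using a(1) by simp
  then show False using v(2) by linarith
qed

end

section \<open>Isotypic components of the eigenfunctions\<close>

text \<open>Applying \<open>P i\<close> to a linear relation isolates the part in
  \<open>B i\<close>. Used for the decomposition of functions by characters and of forms by
  components.\<close>

lemma (in vector_space) dim_direct_sum:
  assumes fin: "finite I" "\<And>i. i \<in> I \<Longrightarrow> finite (B i)"
    and ind: "\<And>i. i \<in> I \<Longrightarrow> independent (B i)"
    and add: "\<And>i x y. i \<in> I \<Longrightarrow> P i (x + y) = P i x + P i y"
    and scl: "\<And>i c x. i \<in> I \<Longrightarrow> P i (scale c x) = scale c (P i x)"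
    and same: "\<And>i b. i \<in> I \<Longrightarrow> b \<in> B i \<Longrightarrow> P i b = b"
    and other: "\<And>i j b. i \<in> I \<Longrightarrow> j \<in> I \<Longrightarrow> i \<noteq> j \<Longrightarrow> b \<in> B j \<Longrightarrow> P i b = 0"
    and V: "\<And>i. i \<in> I \<Longrightarrow> B i \<subseteq> V" "V \<subseteq> span (\<Union>i\<in>I. B i)"
  shows "dim V = (\<Sum>i\<in>I. card (B i))"
proof -
  have nz: "b \<noteq> 0" if "i \<in> I" "b \<in> B i" for i b
    using ind[OF that(1)] that(2) dependent_zero by blast
  have disj: "B i \<inter> B j = {}" if "i \<in> I" "j \<in> I" "i \<noteq> j" for i j
  proof -
    have False if b: "b \<in> B i" "b \<in> B j" for b
      using same[OF \<open>i \<in> I\<close> b(1)] other[OF \<open>i \<in> I\<close> \<open>j \<in> I\<close> \<open>i \<noteq> j\<close> b(2)] nz[OF \<open>i \<in> I\<close> b(1)]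
      by simp
    then show ?thesis by blast
  qed
  have P_sum: "P i (\<Sum>b\<in>S. scale (u b) b) = (\<Sum>b\<in>S. scale (u b) (P i b))" if i: "i \<in> I" and "finite S" for i S u
    using that(2)
  proof induction
    case empty
    show ?case using scl[OF i, of 0 0] by simp
  qed (simp add: add[OF i] scl[OF i])
  have "independent (\<Union>i\<in>I. B i)"
  proof (rule independent_if_scalars_zero)
    show "finite (\<Union>i\<in>I. B i)" using fin by blast
    fix u b assume z: "(\<Sum>b\<in>(\<Union>i\<in>I. B i). scale (u b) b) = 0" and "b \<in> (\<Union>i\<in>I. B i)"
    then obtain i where i: "i \<in> I" "b \<in> B i" by blast
    have "0 = P i (\<Sum>b\<in>(\<Union>i\<in>I. B i). scale (u b) b)"
      unfolding z using scl[OF i(1), of 0 0] by simp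
    also have "\<dots> = (\<Sum>b\<in>(\<Union>i\<in>I. B i). scale (u b) (P i b))"
      using fin by (intro P_sum[OF i(1)]) blast
    also have "\<dots> = (\<Sum>b\<in>B i. scale (u b) (P i b))"
    proof (rule sum.mono_neutral_right)
      show "\<forall>b\<in>(\<Union>i\<in>I. B i) - B i. scale (u b) (P i b) = 0"
      proof
        fix b assume "b \<in> (\<Union>i\<in>I. B i) - B i"
        then obtain j where "j \<in> I" "b \<in> B j" "i \<noteq> j" by blast
        then show "scale (u b) (P i b) = 0" using other[OF i(1)] by simp
      qed
    qed (use fin i in auto)
    also have "\<dots> = (\<Sum>b\<in>B i. scale (u b) b)" using same[OF i(1)] by simp
    finally have "(\<Sum>b\<in>B i. scale (u b) b) = 0" by simp
    then show "u b = 0"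
      using independentD[OF ind[OF i(1)] fin(2)[OF i(1)] subset_refl _ i(2), of u] by simp
  qed
  then have "dim V = card (\<Union>i\<in>I. B i)"
    using V by (intro dim_unique[OF _ _ _ refl]) blast+
  also have "\<dots> = (\<Sum>i\<in>I. card (B i))"
    using fin disj by (intro card_UN_disjoint) auto
  finally show ?thesis .
qed

text \<open>Expand the product; \<open>J\<close> records the factors from which \<open>a i\<close>
  is taken.\<close>

lemma sum_Pow_prod:
  fixes a :: "'a \<Rightarrow> 'b::comm_semiring_1"
  assumes "finite S"
  shows "(\<Sum>J\<in>Pow S. \<Prod>i\<in>J. a i) = (\<Prod>i\<in>S. 1 + a i)"
  using assms
proof induction
  case (insert x S)
  have fin: "finite J" if "J \<in> Pow S" for J using that insert.hyps finite_subset by auto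
  have "(\<Sum>J\<in>Pow (insert x S). \<Prod>i\<in>J. a i) =
     (\<Sum>J\<in>Pow S. \<Prod>i\<in>J. a i) + (\<Sum>J\<in>insert x ` Pow S. \<Prod>i\<in>J. a i)"
    unfolding Pow_insert using insert.hyps by (intro sum.union_disjoint) auto
  also have "(\<Sum>J\<in>insert x ` Pow S. \<Prod>i\<in>J. a i) = (\<Sum>J\<in>Pow S. \<Prod>i\<in>insert x J. a i)"
    using insert.hyps by (subst sum.reindex) (auto simp: inj_on_def)
  also have "\<dots> = (\<Sum>J\<in>Pow S. a x * (\<Prod>i\<in>J. a i))"
    using insert.hyps fin by (intro sum.cong refl prod.insert) auto
  finally show ?case using insert by (simp add: sum_distrib_left[symmetric] distrib_right)
qed simp

lemma cas_iso_act:
  "cas l (iso_act g x) = cos (2 * pi * (l \<bullet> snd g)) * cas (transpose (fst g) *v l) x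
     + sin (2 * pi * (l \<bullet> snd g)) * cas (- (transpose (fst g) *v l)) x"
proof -
  have "cas m (fst g *v x) = cas (transpose (fst g) *v m) x" for m
    using dot_lmul_matrix[of m "fst g" x] by (simp add: cas_def)
  from this[of l] this[of "- l"] show ?thesis
    using linear_neg[OF matrix_vector_mul_linear, of "transpose (fst g)" l]
    by (simp add: iso_act_def cas_plus_right)
qed

locale flat_Z2 = bieberbach_Z2 G k + frame U U'
  for G :: "'n::finite isom set" and k and U U' :: "real^'n^'n" +
  assumes eigen: "\<And>B i. B \<in> linear_parts \<Longrightarrow> B *v U $ i = U $ i \<or> B *v U $ i = - U $ i"
begin

text \<open>The eigenvalue of \<open>B\<close> on the \<open>i\<close>-th basis vector, meaningful
  for linear parts, for which each basis vector is fixed or negated.\<close>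

definition sgn_at :: "real^'n^'n \<Rightarrow> 'n \<Rightarrow> real" where
  "sgn_at B i = (if B *v U $ i = U $ i then 1 else - 1)"

definition chi :: "'n set \<Rightarrow> real^'n^'n \<Rightarrow> real" where
  "chi J B = (\<Prod>i\<in>J. sgn_at B i)"

lemma sgn_at_eigen: "B \<in> linear_parts \<Longrightarrow> B *v U $ i = sgn_at B i *\<^sub>R U $ i"
  using eigen[of B i] by (auto simp: sgn_at_def)

lemma row_nonzero: "U $ i \<noteq> 0"
proof
  assume "U $ i = 0"
  then have "axis i (1::real) = 0" using coords_row[of i] by simp
  then have "axis i (1::real) $ i = (0 :: real^'n) $ i" by (simp only:)
  then show False by simp
qed

lemma sgn_at_mult:
  assumes "B \<in> linear_parts" "C \<in> linear_parts"
  shows "sgn_at (B ** C) i = sgn_at B i * sgn_at C i"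
proof -
  have "sgn_at (B ** C) i *\<^sub>R U $ i = B *v (C *v U $ i)"
    using sgn_at_eigen[OF linear_parts_mult[OF assms]] by (simp add: matrix_vector_mul_assoc)
  also have "\<dots> = (sgn_at B i * sgn_at C i) *\<^sub>R U $ i"
    by (simp add: sgn_at_eigen assms matrix_vector_mult_scaleR)
  finally show ?thesis using row_nonzero[of i] by simp
qed

lemma sgn_at_one: "sgn_at (mat 1) i = 1"
  by (simp add: sgn_at_def)

lemma sgn_at_cases: "sgn_at B i = 1 \<or> sgn_at B i = - 1"
  by (simp add: sgn_at_def)

lemma chi_cases: "chi J B = 1 \<or> chi J B = - 1"
  unfolding chi_def
proof (induction J rule: infinite_finite_induct)
  case (insert i J)
  then show ?case using sgn_at_cases[of B i] by auto
qed auto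

lemma chi_square: "chi J B * chi J B = 1"
  using chi_cases[of J B] by auto

lemma chi_mult: "B \<in> linear_parts \<Longrightarrow> C \<in> linear_parts \<Longrightarrow> chi J (B ** C) = chi J B * chi J C"
  by (simp add: chi_def sgn_at_mult prod.distrib)

lemma chi_one: "chi J (mat 1) = 1"
  by (simp add: chi_def sgn_at_one)

lemma scalar_linear_part:
  assumes B: "B \<in> linear_parts" and c: "\<And>i. sgn_at B i = c"
  shows "B = c *\<^sub>R mat 1"
  unfolding matrix_eq
proof
  fix x
  have "B *v x = B *v (\<Sum>i\<in>UNIV. (x v* U') $ i *\<^sub>R U $ i)"
    by (simp add: expand_row[of x, symmetric])
  also have "\<dots> = (\<Sum>i\<in>UNIV. (x v* U') $ i *\<^sub>R (B *v U $ i))"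
    by (simp add: linear_sum[OF matrix_vector_mul_linear] matrix_vector_mult_scaleR)
  also have "\<dots> = (\<Sum>i\<in>UNIV. c *\<^sub>R (x v* U') $ i *\<^sub>R U $ i)"
    using sgn_at_eigen[OF B] c by (intro sum.cong refl) (simp add: mult.commute)
  also have "\<dots> = c *\<^sub>R x"
    by (simp only: scaleR_right.sum[symmetric] expand_row[of x, symmetric])
  finally show "B *v x = (c *\<^sub>R mat 1) *v x" by (simp add: scaleR_matrix_vector_assoc[symmetric])
qed

text \<open>An element all of whose signs agree is a scalar matrix. The second part thus rests on
  the absence of \<open>- mat 1\<close>; it balances even and odd sets.\<close>

lemma exists_sgn_at:
  assumes B: "B \<in> linear_parts"
  shows "B \<noteq> mat 1 \<Longrightarrow> \<exists>i. sgn_at B i = - 1" "\<exists>i. sgn_at B i = 1"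
proof -
  show "\<exists>i. sgn_at B i = - 1" if "B \<noteq> mat 1"
    using scalar_linear_part[OF B, of 1] sgn_at_cases[of B] that by auto
  show "\<exists>i. sgn_at B i = 1"
  proof (rule ccontr)
    assume "\<not> ?thesis"
    then have "sgn_at B i = - 1" for i using sgn_at_cases[of B i] by auto
    then have "B = - mat 1" using scalar_linear_part[OF B] by auto
    then show False using B uminus_one_notin_linear_parts by simp
  qed
qed

lemma sum_chi:
  assumes "B \<in> linear_parts"
  shows "(\<Sum>J\<in>UNIV. chi J B) = (if B = mat 1 then 2 ^ CARD('n) else 0)"
proof -
  have "(\<Sum>J\<in>UNIV. chi J B) = (\<Prod>i\<in>UNIV. 1 + sgn_at B i)"
    unfolding chi_def using sum_Pow_prod[of UNIV "sgn_at B"] by simp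
  moreover have "(\<Prod>i\<in>UNIV. 1 + sgn_at B i) = 0" if "B \<noteq> mat 1"
  proof (rule prod_zero)
    have "\<exists>i. sgn_at B i = - 1" using exists_sgn_at(1)[OF assms that] .
    then obtain i where "sgn_at B i = - 1" ..
    then show "\<exists>i\<in>UNIV. 1 + sgn_at B i = 0" by (intro bexI[of _ i]) simp_all
  qed simp
  ultimately show ?thesis by (simp add: sgn_at_one)
qed

text \<open>The sign turns each factor into the negative of \<open>sgn_at B i\<close>, so an
  eigenvalue 1 of \<open>B\<close> makes the product vanish, for \<open>B = mat 1\<close> as
  well.\<close>

lemma sum_alternating_chi:
  assumes "B \<in> linear_parts"
  shows "(\<Sum>J\<in>UNIV. (-1) ^ card J * chi J B) = 0"
proof -
  have "(\<Sum>J\<in>UNIV. (-1) ^ card J * chi J B) = (\<Sum>J\<in>UNIV. \<Prod>i\<in>J. - sgn_at B i)"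
    by (simp add: chi_def prod_uminus)
  also have "\<dots> = (\<Prod>i\<in>UNIV. 1 + (- sgn_at B i))"
    using sum_Pow_prod[of UNIV "\<lambda>i. - sgn_at B i"] by simp
  also have "\<dots> = 0"
  proof (rule prod_zero)
    show "\<exists>i\<in>UNIV. 1 + (- sgn_at B i) = 0" using exists_sgn_at(2)[OF assms] by simp
  qed simp
  finally show ?thesis .
qed

lemma sum_chi_parity:
  assumes "B \<in> linear_parts"
  shows "(\<Sum>J | even (card J) = e. chi J B) = (if B = mat 1 then 2 ^ (CARD('n) - 1) else 0)"
proof -
  \<comment> \<open>The indicator of the chosen parity is (1 + s (-1)^card J) / 2.\<close>
  define s :: real where "s = (if e then 1 else - 1)"
  have "(\<Sum>J | even (card J) = e. chi J B) = (\<Sum>J\<in>UNIV. if even (card J) = e then chi J B else 0)"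
    by (simp add: sum.If_cases)
  also have "\<dots> = (\<Sum>J\<in>UNIV. chi J B / 2 + s / 2 * ((-1) ^ card J * chi J B))"
    by (intro sum.cong refl) (cases e; simp add: s_def)
  also have "\<dots> = (\<Sum>J\<in>UNIV. chi J B) / 2 + s / 2 * (\<Sum>J\<in>UNIV. (-1) ^ card J * chi J B)"
    by (simp only: sum.distrib sum_divide_distrib[symmetric] sum_distrib_left[symmetric])
  also have "\<dots> = (if B = mat 1 then 2 ^ CARD('n) else 0) / 2"
    by (simp add: sum_chi sum_alternating_chi assms)
  also have "\<dots> = (if B = mat 1 then 2 ^ (CARD('n) - 1) else 0)"
    using power_eq_if[of "2::real" "CARD('n)"] by simp
  finally show ?thesis .
qed

lemma bij_mult_linear_part:
  assumes "C \<in> linear_parts"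
  shows "bij_betw (\<lambda>B. B ** C) linear_parts linear_parts"
proof (rule bij_betwI[where g = "\<lambda>B. B ** C"])
  have "B ** C ** C = B" for B
    using linear_parts_square[OF assms assms] by (simp add: matrix_mul_assoc[symmetric])
  then show "B ** C ** C = B" "B ** C ** C = B" for B by auto
qed (use assms linear_parts_mult in auto)

text \<open>If the characters differ at \<open>C\<close>, reindexing the sum by multiplication with
  \<open>C\<close> changes its sign.\<close>

lemma chi_orthogonal:
  "(\<Sum>B\<in>linear_parts. chi J B * chi K B) =
     (if \<forall>B\<in>linear_parts. chi J B = chi K B then 2 ^ k else 0)"
proof (cases "\<forall>B\<in>linear_parts. chi J B = chi K B")
  case True
  then show ?thesis by (simp add: chi_square card_linear_parts)
next
  case False
  then obtain C where C: "C \<in> linear_parts" "chi J C \<noteq> chi K C" by blast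
  have c: "chi J C * chi K C = - 1" using C(2) chi_cases[of J C] chi_cases[of K C] by auto
  let ?f = "\<lambda>B. chi J B * chi K B"
  have "sum ?f linear_parts = (\<Sum>B\<in>linear_parts. ?f (B ** C))"
    by (rule sum.reindex_bij_betw[OF bij_mult_linear_part[OF C(1)], symmetric])
  also have "\<dots> = (\<Sum>B\<in>linear_parts. (chi J C * chi K C) * ?f B)"
    by (intro sum.cong refl) (simp add: chi_mult C(1))
  also have "\<dots> = - sum ?f linear_parts" by (simp add: c sum_negf)
  finally show ?thesis using False by simp
qed

text \<open>Count pairs in two ways: summing over \<open>B\<close> first detects equality of
  characters with weight 2^k, while summing over \<open>J\<close> first leaves only
  \<open>B = mat 1\<close> with 2^(n-1).\<close>

lemma card_chi_parity:
  assumes "k < CARD('n)"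
  shows "card {J. even (card J) = e \<and> (\<forall>B\<in>linear_parts. chi J B = chi K B)} = 2 ^ (CARD('n) - k - 1)"
proof -
  let ?E = "{J :: 'n set. even (card J) = e}"
  let ?S = "{J. even (card J) = e \<and> (\<forall>B\<in>linear_parts. chi J B = chi K B)}"
  have "2 ^ k * real (card ?S) = (\<Sum>J\<in>?S. 2 ^ k)" by simp
  also have "\<dots> = (\<Sum>J\<in>?E. if \<forall>B\<in>linear_parts. chi J B = chi K B then 2 ^ k else 0)"
    by (rule sum.mono_neutral_cong_left) auto
  also have "\<dots> = (\<Sum>J\<in>?E. \<Sum>B\<in>linear_parts. chi J B * chi K B)"
    by (simp only: chi_orthogonal)
  also have "\<dots> = (\<Sum>B\<in>linear_parts. (\<Sum>J\<in>?E. chi J B) * chi K B)"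
    by (subst sum.swap) (simp only: sum_distrib_right)
  also have "\<dots> = (\<Sum>B\<in>linear_parts. if B = mat 1 then 2 ^ (CARD('n) - 1) else 0)"
    by (intro sum.cong refl) (simp add: sum_chi_parity chi_one)
  also have "\<dots> = 2 ^ (CARD('n) - 1)"
    using finite_linear_parts linear_parts_one by simp
  also have "(2::real) ^ (CARD('n) - 1) = 2 ^ k * 2 ^ (CARD('n) - k - 1)"
    using assms by (simp add: power_add[symmetric])
  finally have "real (card ?S) = real (2 ^ (CARD('n) - k - 1))" by simp
  then show ?thesis by (simp only: of_nat_eq_iff)
qed

section \<open>Decomposition of the eigenfunctions by characters of the holonomy\<close>

abbreviation L :: "(real^'n) set" where "L \<equiv> transl_lattice G"

definition isotypic :: "real \<Rightarrow> (real^'n^'n \<Rightarrow> real) \<Rightarrow> (real^'n \<Rightarrow> real) set" where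
  "isotypic t c = {f \<in> efun L t. \<forall>g\<in>G. \<forall>x. f (iso_act g x) = c (fst g) * f x}"

lemma isotypic_cong:
  assumes "\<And>B. B \<in> linear_parts \<Longrightarrow> c B = c' B"
  shows "isotypic t c = isotypic t c'"
  using assms by (auto simp: isotypic_def linear_parts_def)

lemma lattice_basis: "\<exists>A :: real^'n^'n. period_matrix A \<and> (\<forall>j. A $ j \<in> L)"
  using span_UNIV_invertible_rows[OF span_transl_lattice] by (auto simp: period_matrix_def)

lemma finite_freq_L: "finite (freq L t)"
  and inj_on_cas_L: "inj_on cas (freq L t)"
  and independent_cas_L: "fv.independent (cas ` freq L t)"
  and efun_L: "efun L t = fv.span (cas ` freq L t)"
proof -
  obtain A where "period_matrix A" and A: "\<And>j. A $ j \<in> L" using lattice_basis by blast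
  then interpret period_matrix A by simp
  show "finite (freq L t)" "inj_on cas (freq L t)" "fv.independent (cas ` freq L t)"
    "efun L t = fv.span (cas ` freq L t)"
    by (rule finite_freq[OF A] inj_on_cas[OF A] independent_cas[OF A] efun_eq_span[OF A])+
qed

lemma dim_efun: "fv.dim (efun L t) = card (freq L t)"
  unfolding efun_L fv.dim_span
  using fv.dim_eq_card_independent[OF independent_cas_L] card_image[OF inj_on_cas_L] by simp

text \<open>Finiteness comes from the finite spanning set of all eigenfunctions.\<close>

lemma isotypic_basis:
  obtains Bs where "Bs \<subseteq> isotypic t c" "fv.independent Bs" "isotypic t c \<subseteq> fv.span Bs"
    "finite Bs" "card Bs = fv.dim (isotypic t c)"
proof -
  obtain Bs where Bs: "Bs \<subseteq> isotypic t c" "fv.independent Bs" "isotypic t c \<subseteq> fv.span Bs"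
    "card Bs = fv.dim (isotypic t c)"
    by (rule fv.basis_exists)
  have "Bs \<subseteq> fv.span (cas ` freq L t)"
    using Bs(1) unfolding efun_L[symmetric] isotypic_def by blast
  then have "finite Bs"
    using fv.independent_span_bound[OF finite_imageI[OF finite_freq_L] Bs(2)] by blast
  with Bs show ?thesis by (intro that)
qed

lemma freq_transpose:
  assumes g: "g \<in> G" and l: "l \<in> freq L t"
  shows "transpose (fst g) *v l \<in> freq L t" "- (transpose (fst g) *v l) \<in> freq L t"
proof -
  have "(transpose (fst g) *v l) \<bullet> v = l \<bullet> (fst g *v v)" for v
    using dot_lmul_matrix[of l "fst g" v] by simp
  then have "transpose (fst g) *v l \<in> dual_lattice L"
    using l transl_lattice_conj[OF g] by (auto simp: freq_def dual_lattice_def)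
  moreover have "norm (transpose (fst g) *v l) = norm l"
    using orth_inner[OF inv_mem[OF g], of l l] by (simp add: norm_eq_sqrt_inner fst_iso_inv)
  ultimately show "transpose (fst g) *v l \<in> freq L t" "- (transpose (fst g) *v l) \<in> freq L t"
    using l by (auto simp: freq_def dual_lattice_def)
qed

text \<open>Read off from the spanning functions \<open>cas l\<close>, which \<open>g\<close> sends
  to combinations of \<open>cas\<close> at transformed frequencies, instead of from a chain rule for
  second derivatives.\<close>

lemma efun_iso_act:
  assumes g: "g \<in> G" and f: "f \<in> efun L t"
  shows "(\<lambda>x. f (iso_act g x)) \<in> efun L t"
  using f unfolding efun_L
proof (induction rule: fv_span_induct)
  case zero
  show ?case using fv.span_zero[of "cas ` freq L t"] by (simp add: zero_fun_def)
next
  case (base c f h)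
  then obtain l where l: "l \<in> freq L t" "f = cas l" by auto
  have "(\<lambda>x. f (iso_act g x)) \<in> fv.span (cas ` freq L t)"
    unfolding l(2) cas_iso_act
    by (intro fv_span_add fv_span_cmult fv.span_base imageI freq_transpose g l)
  from fv_span_add[OF fv_span_cmult[OF this] base(2)] show ?case .
qed

text \<open>The action of \<open>G\<close> on eigenfunctions factors through the holonomy, so the
  arbitrary choice in \<open>lift\<close> has no effect on them.\<close>

lemma efun_same_linear_part:
  assumes "g \<in> G" "h \<in> G" "fst g = fst h" "f \<in> efun L t"
  shows "f (iso_act g x) = f (iso_act h x)"
proof -
  obtain v where v: "v \<in> L" "\<And>x. iso_act g x = iso_act h (x + v)"
    using same_linear_part[OF assms(1-3)] by metis
  have "(\<lambda>x. f (iso_act h x)) \<in> efun L t" by (rule efun_iso_act[OF assms(2,4)])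
  then show ?thesis using v by (simp add: efun_def)
qed

definition lift :: "real^'n^'n \<Rightarrow> 'n isom" where
  "lift B = (SOME g. g \<in> G \<and> fst g = B)"

lemma lift:
  assumes "B \<in> linear_parts"
  shows "lift B \<in> G" "fst (lift B) = B"
proof -
  have "\<exists>g. g \<in> G \<and> fst g = B" using assms unfolding linear_parts_def by blast
  from someI_ex[OF this] show "lift B \<in> G" "fst (lift B) = B" by (simp_all add: lift_def)
qed

lemma iso_act_mult: "iso_act (iso_mult g h) x = iso_act g (iso_act h x)"
  by (simp add: iso_act_def iso_mult_def matrix_vector_mul_assoc[symmetric] matrix_vector_right_distrib)

text \<open>The averaging projector of a character over a group of order 2^k; values 1 and -1 are
  their own inverses, so no inverse of \<open>B\<close> appears.\<close>

definition proj :: "(real^'n^'n \<Rightarrow> real) \<Rightarrow> (real^'n \<Rightarrow> real) \<Rightarrow> real^'n \<Rightarrow> real" where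
  "proj c f x = (\<Sum>B\<in>linear_parts. c B * f (iso_act (lift B) x)) / 2 ^ k"

text \<open>Acting by \<open>g\<close> reindexes the sum by multiplication with its linear part,
  which pulls out one value of the character.\<close>

lemma proj_isotypic:
  assumes f: "f \<in> efun L t"
  shows "proj (chi J) f \<in> isotypic t (chi J)"
proof -
  have "(\<lambda>x. (1 / 2 ^ k) * (\<Sum>B\<in>linear_parts. chi J B * f (iso_act (lift B) x))) \<in> efun L t"
    unfolding efun_L
    by (intro fv_span_cmult fv_span_sum efun_iso_act[unfolded efun_L] f[unfolded efun_L] lift)
  moreover have "proj (chi J) f = (\<lambda>x. (1 / 2 ^ k) * (\<Sum>B\<in>linear_parts. chi J B * f (iso_act (lift B) x)))"
    by (simp add: proj_def fun_eq_iff)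
  moreover have "proj (chi J) f (iso_act g x) = chi J (fst g) * proj (chi J) f x" if g: "g \<in> G" for g x
  proof -
    define C where "C = fst g"
    have C: "C \<in> linear_parts" using g by (auto simp: C_def linear_parts_def)
    have "(\<Sum>B\<in>linear_parts. chi J B * f (iso_act (lift B) (iso_act g x))) =
      (\<Sum>B\<in>linear_parts. chi J C * (chi J (B ** C) * f (iso_act (lift (B ** C)) x)))"
    proof (intro sum.cong refl)
      fix B assume B: "B \<in> linear_parts"
      have BC: "B ** C \<in> linear_parts" using B C by (rule linear_parts_mult)
      have "f (iso_act (lift B) (iso_act g x)) = f (iso_act (lift (B ** C)) x)"
        unfolding iso_act_mult[symmetric]
        by (rule efun_same_linear_part[OF mult_mem[OF lift(1)[OF B] g] lift(1)[OF BC] _ f])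
          (simp add: fst_iso_mult lift B BC C_def[symmetric])
      moreover have "chi J B = chi J C * chi J (B ** C)"
        using chi_square[of J C] by (simp add: chi_mult B C mult.commute mult.assoc)
      ultimately show "chi J B * f (iso_act (lift B) (iso_act g x)) =
        chi J C * (chi J (B ** C) * f (iso_act (lift (B ** C)) x))"
        by simp
    qed
    also have "\<dots> = chi J C * (\<Sum>B\<in>linear_parts. chi J (B ** C) * f (iso_act (lift (B ** C)) x))"
      by (rule sum_distrib_left[symmetric])
    also have "(\<Sum>B\<in>linear_parts. chi J (B ** C) * f (iso_act (lift (B ** C)) x)) =
      (\<Sum>B\<in>linear_parts. chi J B * f (iso_act (lift B) x))"
      by (rule sum.reindex_bij_betw[OF bij_mult_linear_part[OF C]])
    finally show ?thesis by (simp add: proj_def C_def)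
  qed
  ultimately show ?thesis by (simp add: isotypic_def)
qed

lemma proj_on_isotypic:
  assumes f: "f \<in> isotypic t (chi K)"
  shows "proj (chi J) f = (if \<forall>B\<in>linear_parts. chi J B = chi K B then f else 0)"
proof -
  have "proj (chi J) f x = (\<Sum>B\<in>linear_parts. chi J B * chi K B) * f x / 2 ^ k" for x
    unfolding proj_def sum_distrib_right
    using f lift by (intro arg_cong2[of _ _ _ _ "(/)"] sum.cong refl) (simp add: isotypic_def)
  then show ?thesis unfolding chi_orthogonal by (auto simp: fun_eq_iff)
qed

text \<open>By \<open>sum_chi\<close> only the identity survives the sum over \<open>J\<close>. The
  factor compensates that each occurring character comes from 2^(n-k) sets.\<close>

lemma sum_proj:
  assumes f: "f \<in> efun L t"
  shows "f x = (2 ^ k / 2 ^ CARD('n)) * (\<Sum>J\<in>UNIV. proj (chi J) f x)"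
proof -
  have "(\<Sum>J\<in>UNIV. proj (chi J) f x) =
    (\<Sum>J\<in>UNIV. \<Sum>B\<in>linear_parts. chi J B * f (iso_act (lift B) x)) / 2 ^ k"
    by (simp add: proj_def sum_divide_distrib)
  also have "\<dots> = (\<Sum>B\<in>linear_parts. (\<Sum>J\<in>UNIV. chi J B) * f (iso_act (lift B) x)) / 2 ^ k"
    by (subst sum.swap) (simp only: sum_distrib_right)
  also have "\<dots> = (\<Sum>B\<in>linear_parts. if B = mat 1 then 2 ^ CARD('n) * f (iso_act (lift B) x) else 0) / 2 ^ k"
    by (intro arg_cong2[of _ _ _ _ "(/)"] sum.cong refl) (simp add: sum_chi)
  also have "\<dots> = 2 ^ CARD('n) * f (iso_act (lift (mat 1)) x) / 2 ^ k"
    using finite_linear_parts linear_parts_one by simp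
  also have "f (iso_act (lift (mat 1)) x) = f (iso_act iso_one x)"
    by (rule efun_same_linear_part[OF lift(1)[OF linear_parts_one] one_mem _ f])
      (simp add: lift linear_parts_one iso_one_def)
  finally show ?thesis by (simp add: iso_act_def iso_one_def)
qed

text \<open>Different sets can induce the same character; restriction to \<open>linear_parts\<close>
  makes such characters equal as functions, so each is counted once.\<close>

definition chars :: "(real^'n^'n \<Rightarrow> real) set" where
  "chars = (\<lambda>J. restrict (chi J) linear_parts) ` UNIV"

lemma isotypic_restrict: "isotypic t (restrict c linear_parts) = isotypic t c"
  by (rule isotypic_cong) simp

lemma restrict_chi_eq_iff:
  "restrict (chi J) linear_parts = restrict (chi K) linear_parts \<longleftrightarrow> (\<forall>B\<in>linear_parts. chi J B = chi K B)"
  by (auto simp: fun_eq_iff restrict_def)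

lemma proj_restrict: "proj (restrict c linear_parts) = proj c"
  by (simp add: proj_def fun_eq_iff)

lemma proj_add: "proj c (f + g) = proj c f + proj c g"
  by (simp add: proj_def fun_eq_iff distrib_left sum.distrib add_divide_distrib)

lemma proj_fscl: "proj c (fscl a f) = fscl a (proj c f)"
  by (simp add: proj_def fscl_def fun_eq_iff sum_distrib_left mult.left_commute)

lemma sum_dim_isotypic: "(\<Sum>c\<in>chars. fv.dim (isotypic t c)) = card (freq L t)"
proof -
  have "\<exists>Bs. Bs \<subseteq> isotypic t c \<and> fv.independent Bs \<and> isotypic t c \<subseteq> fv.span Bs \<and>
    finite Bs \<and> card Bs = fv.dim (isotypic t c)" for c
    by (rule isotypic_basis[of t c]) blast
  then obtain Bs where Bs: "\<And>c. Bs c \<subseteq> isotypic t c" "\<And>c. fv.independent (Bs c)"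
    "\<And>c. isotypic t c \<subseteq> fv.span (Bs c)" "\<And>c. finite (Bs c)" "\<And>c. card (Bs c) = fv.dim (isotypic t c)"
    by metis
  have proj: "proj c f = (if c = c' then f else 0)"
    if "c \<in> chars" "c' \<in> chars" "f \<in> isotypic t c'" for c c' f
  proof -
    obtain J K where JK: "c = restrict (chi J) linear_parts" "c' = restrict (chi K) linear_parts"
      using \<open>c \<in> chars\<close> \<open>c' \<in> chars\<close> unfolding chars_def by blast
    show ?thesis
      using proj_on_isotypic[of f t K J] that(3)
      by (simp only: JK proj_restrict isotypic_restrict restrict_chi_eq_iff)
  qed
  have "fv.dim (efun L t) = (\<Sum>c\<in>chars. card (Bs c))"
  proof (rule fv.dim_direct_sum[where P = proj])
    show "finite chars" by (simp add: chars_def)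
    show "Bs c \<subseteq> efun L t" for c using Bs(1)[of c] by (auto simp: isotypic_def)
    show "proj c b = b" if "c \<in> chars" "b \<in> Bs c" for c b
      using proj[OF that(1,1)] that(2) Bs(1) by auto
    show "proj c b = 0" if "c \<in> chars" "c' \<in> chars" "c \<noteq> c'" "b \<in> Bs c'" for c c' b
      using proj[OF that(1,2)] that(3,4) Bs(1) by auto
    show "efun L t \<subseteq> fv.span (\<Union>c\<in>chars. Bs c)"
    proof
      fix f assume f: "f \<in> efun L t"
      have mem: "proj (chi J) f \<in> fv.span (\<Union>c\<in>chars. Bs c)" for J
      proof -
        define c where "c = restrict (chi J) linear_parts"
        have "c \<in> chars" by (simp add: c_def chars_def)
        have "proj (chi J) f \<in> fv.span (Bs c)"
          using proj_isotypic[OF f, of J] Bs(3)[of c] isotypic_restrict[of t "chi J"]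
          unfolding c_def by blast
        then show ?thesis using fv.span_mono[of "Bs c" "\<Union>c\<in>chars. Bs c"] \<open>c \<in> chars\<close> by blast
      qed
      have "f = (\<lambda>x. (2 ^ k / 2 ^ CARD('n)) * (\<Sum>J\<in>UNIV. proj (chi J) f x))"
        using sum_proj[OF f] by (rule ext)
      also have "\<dots> \<in> fv.span (\<Union>c\<in>chars. Bs c)"
        by (intro fv_span_cmult fv_span_sum mem)
      finally show "f \<in> fv.span (\<Union>c\<in>chars. Bs c)" .
    qed
  qed (use Bs proj_add proj_fscl in auto)
  then show ?thesis by (simp add: dim_efun Bs(5))
qed

text \<open>Grouping the sets by their character gives classes of equal size, so the sum is that
  size times the sum over distinct characters.\<close>

lemma sum_dim_isotypic_parity:
  assumes "k < CARD('n)"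
  shows "(\<Sum>J | even (card J) = e. fv.dim (isotypic t (chi J))) = 2 ^ (CARD('n) - k - 1) * card (freq L t)"
proof -
  let ?E = "{J :: 'n set. even (card J) = e}"
  let ?r = "\<lambda>J. restrict (chi J) linear_parts"
  have "(\<Sum>J\<in>?E. fv.dim (isotypic t (chi J))) =
    (\<Sum>c\<in>chars. \<Sum>J\<in>{J \<in> ?E. ?r J = c}. fv.dim (isotypic t (chi J)))"
    by (rule sum.group[symmetric]) (auto simp: chars_def)
  also have "\<dots> = (\<Sum>c\<in>chars. 2 ^ (CARD('n) - k - 1) * fv.dim (isotypic t c))"
  proof (rule sum.cong[OF refl])
    fix c assume "c \<in> chars"
    then obtain K where K: "c = ?r K" by (auto simp: chars_def)
    have "(\<Sum>J\<in>{J \<in> ?E. ?r J = c}. fv.dim (isotypic t (chi J))) = (\<Sum>J\<in>{J \<in> ?E. ?r J = c}. fv.dim (isotypic t c))"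
      by (rule sum.cong) (use isotypic_restrict in auto)
    also have "\<dots> = card {J \<in> ?E. ?r J = c} * fv.dim (isotypic t c)" by simp
    also have "card {J \<in> ?E. ?r J = c} = 2 ^ (CARD('n) - k - 1)"
      using card_chi_parity[OF assms, of e K] by (simp only: K restrict_chi_eq_iff mem_Collect_eq)
    finally show "(\<Sum>J\<in>{J \<in> ?E. ?r J = c}. fv.dim (isotypic t (chi J))) =
      2 ^ (CARD('n) - k - 1) * fv.dim (isotypic t c)" .
  qed
  also have "\<dots> = 2 ^ (CARD('n) - k - 1) * card (freq L t)"
    by (simp only: sum_distrib_left[symmetric] sum_dim_isotypic)
  finally show ?thesis .
qed

end

section \<open>Multiplicities\<close>

interpretation form_vs: vector_space fscale
  by standard (auto simp: fscale_def fun_eq_iff algebra_simps)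

interpretation fun_form: vector_space_pair fscl fscale ..

lemma sum_form_apply:
  fixes F :: "'i \<Rightarrow> 'n::finite form"
  shows "(\<Sum>i\<in>I. F i) x vs = (\<Sum>i\<in>I. F i x vs)"
  by (induction I rule: infinite_finite_induct) auto

context flat_Z2
begin

text \<open>Translations act trivially on tangent vectors, so invariance under them is periodicity
  of the coefficients; the Hodge Laplacian also acts coefficientwise.\<close>

lemma eigenspace_iff:
  "\<omega> \<in> eigenspace G p t \<longleftrightarrow> (\<forall>x. alt_multilinear p (\<omega> x)) \<and> (\<forall>vs. (\<lambda>x. \<omega> x vs) \<in> efun L t) \<and>
     (\<forall>g\<in>G. \<forall>x vs. \<omega> (iso_act g x) (\<lambda>i. fst g *v vs i) = \<omega> x vs)"
proof
  assume \<omega>: "\<omega> \<in> eigenspace G p t"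
  then have sm: "smooth_fun (\<lambda>x. \<omega> x vs)" for vs
    by (simp add: eigenspace_def forms_def is_pform_def)
  have inv: "\<omega> (iso_act g x) (\<lambda>i. fst g *v vs i) = \<omega> x vs" if "g \<in> G" for g x vs
  proof -
    have "pullback g \<omega> = \<omega>" using \<omega> that by (simp add: eigenspace_def forms_def)
    from fun_cong[OF fun_cong[OF this]] show ?thesis by (simp add: pullback_def)
  qed
  have "(\<lambda>x. \<omega> x vs) \<in> efun L t" for vs
  proof -
    have "\<omega> (x + v) vs = \<omega> x vs" if "v \<in> L" for v x
      using inv[of "(mat 1, v)" x vs] that by (simp add: transl_lattice_def iso_act_def)
    moreover have "lap (\<lambda>x. \<omega> x vs) x = - t * \<omega> x vs" for x
    proof -
      have "hodge_lap p \<omega> = fscale t \<omega>" using \<omega> by (simp add: eigenspace_def)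
      from fun_cong[OF fun_cong[OF this, of x], of vs] show ?thesis
        by (simp add: hodge_lap_eq_lap[OF sm] fscale_def)
    qed
    ultimately show ?thesis using sm by (simp add: efun_def)
  qed
  then show "(\<forall>x. alt_multilinear p (\<omega> x)) \<and> (\<forall>vs. (\<lambda>x. \<omega> x vs) \<in> efun L t) \<and>
     (\<forall>g\<in>G. \<forall>x vs. \<omega> (iso_act g x) (\<lambda>i. fst g *v vs i) = \<omega> x vs)"
    using \<omega> inv by (simp add: eigenspace_def forms_def is_pform_def)
next
  assume *: "(\<forall>x. alt_multilinear p (\<omega> x)) \<and> (\<forall>vs. (\<lambda>x. \<omega> x vs) \<in> efun L t) \<and>
     (\<forall>g\<in>G. \<forall>x vs. \<omega> (iso_act g x) (\<lambda>i. fst g *v vs i) = \<omega> x vs)"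
  then have sm: "smooth_fun (\<lambda>x. \<omega> x vs)" for vs by (simp add: efun_def)
  have "hodge_lap p \<omega> = fscale t \<omega>"
    using * by (simp add: fun_eq_iff hodge_lap_eq_lap[OF sm] fscale_def efun_def)
  then show "\<omega> \<in> eigenspace G p t"
    using * sm by (simp add: eigenspace_def forms_def is_pform_def pullback_def)
qed

lemma alt_multilinear_linear_part:
  assumes f: "alt_multilinear (card J) f" and B: "B \<in> linear_parts"
  shows "f (\<lambda>j. B *v basis_vecs J j) = chi J B * f (basis_vecs J)"
proof -
  have "f (\<lambda>j. B *v basis_vecs J j) = f (\<lambda>j. sgn_at B (enum J j) *\<^sub>R basis_vecs J j)"
    by (simp add: basis_vecs_def sgn_at_eigen[OF B])
  also have "\<dots> = (\<Prod>j<card J. sgn_at B (enum J j)) * f (basis_vecs J)"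
    by (rule alt_multilinear_scale[OF f])
  also have "(\<Prod>j<card J. sgn_at B (enum J j)) = chi J B"
    unfolding chi_def by (rule prod.reindex_bij_betw[OF bij_betw_enum]) simp
  finally show ?thesis .
qed

text \<open>Expand the transformed form in elementary forms: on basis tuples \<open>B\<close> only
  contributes signs, so no term other than that of \<open>J\<close> appears.\<close>

lemma basis_form_linear_part:
  assumes B: "B \<in> linear_parts"
  shows "basis_form J (\<lambda>i. B *v vs i) = chi J B * basis_form J vs"
proof -
  have "basis_form J (\<lambda>i. B *v vs i) =
    (\<Sum>K | card K = card J. basis_form J (\<lambda>i. B *v basis_vecs K i) * basis_form K vs)"
    by (rule alt_multilinear_expand[OF alt_multilinear_compose[OF alt_multilinear_basis_form]])
  also have "\<dots> = (\<Sum>K | card K = card J. if K = J then chi J B * basis_form J vs else 0)"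
  proof (rule sum.cong[OF refl])
    fix K :: "'n set" assume "K \<in> {K. card K = card J}"
    then have K: "card J = card K" by simp
    have "basis_form J (\<lambda>i. B *v basis_vecs K i) = chi K B * basis_form J (basis_vecs K)"
      by (rule alt_multilinear_linear_part[OF _ B]) (use alt_multilinear_basis_form[of J] K in simp)
    then show "basis_form J (\<lambda>i. B *v basis_vecs K i) * basis_form K vs =
      (if K = J then chi J B * basis_form J vs else 0)"
      by (simp add: basis_form_basis_vecs[OF K])
  qed
  also have "\<dots> = chi J B * basis_form J vs" by simp
  finally show ?thesis .
qed

section \<open>Passage between forms and their scalar components\<close>

definition scalar_form :: "'n set \<Rightarrow> (real^'n \<Rightarrow> real) \<Rightarrow> 'n form" where
  "scalar_form J f = (\<lambda>x vs. f x * basis_form J vs)"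

definition component :: "'n set \<Rightarrow> 'n form \<Rightarrow> real^'n \<Rightarrow> real" where
  "component J \<omega> = (\<lambda>x. \<omega> x (basis_vecs J))"

lemma linear_scalar_form: "Vector_Spaces.linear fscl fscale (scalar_form J)"
  by (rule Vector_Spaces.linear_iff[THEN iffD2])
    (simp add: fv.vector_space_axioms form_vs.vector_space_axioms scalar_form_def fscl_def fscale_def
      fun_eq_iff algebra_simps)

lemma component_scalar_form:
  "card J = card K \<Longrightarrow> component J (scalar_form K f) = (if J = K then f else 0)"
  by (auto simp: component_def scalar_form_def basis_form_basis_vecs fun_eq_iff)

text \<open>The function and the elementary form are multiplied by the same sign under
  \<open>g\<close>, and its square is 1.\<close>

lemma scalar_form_eigenspace:
  assumes f: "f \<in> isotypic t (chi J)"
  shows "scalar_form J f \<in> eigenspace G (card J) t"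
  unfolding eigenspace_iff
proof (intro conjI allI ballI)
  show "alt_multilinear (card J) (scalar_form J f x)" for x
    unfolding scalar_form_def by (rule alt_multilinear_cmult[OF alt_multilinear_basis_form])
  show "(\<lambda>x. scalar_form J f x vs) \<in> efun L t" for vs
    using fv.subspace_scale[OF efun_subspace, of f L t "basis_form J vs"] f
    by (simp add: isotypic_def fscl_def scalar_form_def mult.commute)
  fix g x vs assume g: "g \<in> G"
  then have B: "fst g \<in> linear_parts" by (simp add: linear_parts_def)
  have "f (iso_act g x) = chi J (fst g) * f x" using f g by (simp add: isotypic_def)
  then have "scalar_form J f (iso_act g x) (\<lambda>i. fst g *v vs i) =
      (chi J (fst g) * chi J (fst g)) * (f x * basis_form J vs)"
    by (simp add: scalar_form_def basis_form_linear_part[OF B])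
  then show "scalar_form J f (iso_act g x) (\<lambda>i. fst g *v vs i) = scalar_form J f x vs"
    by (simp add: chi_square scalar_form_def)
qed

lemma component_isotypic:
  assumes \<omega>: "\<omega> \<in> eigenspace G (card J) t"
  shows "component J \<omega> \<in> isotypic t (chi J)"
proof -
  have "component J \<omega> (iso_act g x) = chi J (fst g) * component J \<omega> x" if g: "g \<in> G" for g x
  proof -
    have B: "fst g \<in> linear_parts" using g by (simp add: linear_parts_def)
    have alt: "alt_multilinear (card J) (\<omega> y)" for y using \<omega> by (simp add: eigenspace_iff)
    have "\<omega> x (basis_vecs J) = \<omega> (iso_act g x) (\<lambda>i. fst g *v basis_vecs J i)"
      using \<omega> g by (simp add: eigenspace_iff)
    also have "\<dots> = chi J (fst g) * \<omega> (iso_act g x) (basis_vecs J)"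
      by (rule alt_multilinear_linear_part[OF alt B])
    finally have "chi J (fst g) * \<omega> x (basis_vecs J) =
        (chi J (fst g) * chi J (fst g)) * \<omega> (iso_act g x) (basis_vecs J)"
      by simp
    then show ?thesis by (simp add: chi_square component_def)
  qed
  then show ?thesis using \<omega> by (simp add: isotypic_def eigenspace_iff component_def)
qed

lemma eigenspace_expand:
  assumes \<omega>: "\<omega> \<in> eigenspace G p t"
  shows "\<omega> = (\<Sum>J | card J = p. scalar_form J (component J \<omega>))"
proof (intro ext)
  fix x vs
  have alt: "alt_multilinear p (\<omega> x)" using \<omega> by (simp add: eigenspace_iff)
  show "\<omega> x vs = (\<Sum>J | card J = p. scalar_form J (component J \<omega>)) x vs"
    using alt_multilinear_expand[OF alt, of vs]
    by (simp add: sum_form_apply scalar_form_def component_def)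
qed

text \<open>The eigenspace is the direct sum of the images of the isotypic spaces under the
  injective maps \<open>scalar_form J\<close>; taking a component and rebuilding its form is the
  projection.\<close>

lemma mult_p_eq: "mult_p G p t = (\<Sum>J | card J = p. fv.dim (isotypic t (chi J)))"
proof -
  have "\<exists>Bs. Bs \<subseteq> isotypic t c \<and> fv.independent Bs \<and> isotypic t c \<subseteq> fv.span Bs \<and>
    finite Bs \<and> card Bs = fv.dim (isotypic t c)" for c
    by (rule isotypic_basis[of t c]) blast
  then obtain Bs where Bs: "\<And>c. Bs c \<subseteq> isotypic t c" "\<And>c. fv.independent (Bs c)"
    "\<And>c. isotypic t c \<subseteq> fv.span (Bs c)" "\<And>c. finite (Bs c)" "\<And>c. card (Bs c) = fv.dim (isotypic t c)"
    by metis
  define FB where "FB J = scalar_form J ` Bs (chi J)" for J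
  have inj: "inj (scalar_form J)" for J
    by (rule inj_on_inverseI[where g = "component J"]) (simp add: component_scalar_form)
  have comp: "scalar_form J (component J b) = (if J = K then b else 0)"
    if "card J = p" "card K = p" "b \<in> FB K" for J K b
    using that
    by (auto simp: FB_def component_scalar_form fun_form.linear_0[OF linear_scalar_form])
  have "mult_p G p t = (\<Sum>J | card J = p. card (FB J))"
    unfolding mult_p_def
  proof (rule form_vs.dim_direct_sum[where P = "\<lambda>J \<omega>. scalar_form J (component J \<omega>)"])
    show "finite (FB J)" for J by (simp add: FB_def Bs)
    show "form_vs.independent (FB J)" for J
      unfolding FB_def
      by (rule fun_form.linear_independent_injective_image[OF linear_scalar_form Bs(2)])
        (rule inj_on_subset[OF inj], simp)
    show "scalar_form J (component J (x + y)) = scalar_form J (component J x) + scalar_form J (component J y)" for J x y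
      by (simp add: scalar_form_def component_def fun_eq_iff distrib_right)
    show "scalar_form J (component J (fscale c x)) = fscale c (scalar_form J (component J x))" for J c x
      by (simp add: scalar_form_def component_def fscale_def fun_eq_iff mult.assoc)
    show "scalar_form J (component J b) = b" if "J \<in> {J. card J = p}" "b \<in> FB J" for J b
      using comp[of J J b] that by simp
    show "scalar_form J (component J b) = 0"
      if "J \<in> {J. card J = p}" "K \<in> {J. card J = p}" "J \<noteq> K" "b \<in> FB K" for J K b
      using comp[of J K b] that by simp
    show "FB J \<subseteq> eigenspace G p t" if "J \<in> {J. card J = p}" for J
      using that Bs(1)[of "chi J"] scalar_form_eigenspace[of _ t J] by (auto simp: FB_def)
    show "eigenspace G p t \<subseteq> form_vs.span (\<Union>J\<in>{J. card J = p}. FB J)"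
    proof
      fix \<omega> assume \<omega>: "\<omega> \<in> eigenspace G p t"
      have "scalar_form J (component J \<omega>) \<in> form_vs.span (\<Union>J\<in>{J. card J = p}. FB J)"
        if J: "card J = p" for J
      proof -
        have "component J \<omega> \<in> fv.span (Bs (chi J))"
          using component_isotypic[of \<omega> J t] \<omega> J Bs(3) by auto
        then have "scalar_form J (component J \<omega>) \<in> form_vs.span (FB J)"
          unfolding FB_def fun_form.linear_span_image[OF linear_scalar_form] by (rule imageI)
        then show ?thesis using form_vs.span_mono[of "FB J" "\<Union>J\<in>{J. card J = p}. FB J"] J by blast
      qed
      then have "(\<Sum>J | card J = p. scalar_form J (component J \<omega>)) \<in>
          form_vs.span (\<Union>J\<in>{J. card J = p}. FB J)"
        by (intro form_vs.span_sum) simp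
      then show "\<omega> \<in> form_vs.span (\<Union>J\<in>{J. card J = p}. FB J)"
        by (simp only: eigenspace_expand[OF \<omega>, symmetric])
    qed
  qed simp
  also have "\<dots> = (\<Sum>J | card J = p. fv.dim (isotypic t (chi J)))"
    using inj by (simp add: FB_def card_image inj_on_subset[OF inj] Bs(5))
  finally show ?thesis .
qed

lemma mult_parity:
  assumes "k < CARD('n)"
  shows "(\<Sum>p\<in>{p. p \<le> CARD('n) \<and> even p = e}. mult_p G p t) = 2 ^ (CARD('n) - k - 1) * card (freq L t)"
proof -
  have le: "card J \<le> CARD('n)" for J :: "'n set" by (rule card_mono) auto
  have "(\<Sum>p\<in>{p. p \<le> CARD('n) \<and> even p = e}. mult_p G p t) =
    (\<Sum>p\<in>{p. p \<le> CARD('n) \<and> even p = e}. \<Sum>J\<in>{J \<in> {J. even (card J) = e}. card J = p}. fv.dim (isotypic t (chi J)))"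
    by (intro sum.cong refl) (auto simp: mult_p_eq intro!: sum.cong)
  also have "\<dots> = (\<Sum>J | even (card J) = e. fv.dim (isotypic t (chi J)))"
    by (rule sum.group) (use le in auto)
  finally show ?thesis by (simp only: sum_dim_isotypic_parity[OF assms])
qed

end

lemma bieberbach_Z2_flat:
  fixes G :: "'n::finite isom set"
  assumes "bieberbach_Z2 G k"
  shows "\<exists>U U'. flat_Z2 G k U U'"
proof -
  interpret bieberbach_Z2 G k by fact
  have "span {v. \<forall>B\<in>linear_parts. B *v v = v \<or> B *v v = - v} = UNIV"
    by (rule span_common_eigenvectors[OF finite_linear_parts linear_parts_square linear_parts_commute])
  from span_UNIV_invertible_rows[OF this]
  obtain U :: "real^'n^'n" where U: "invertible U"
    "\<forall>i. U $ i \<in> {v. \<forall>B\<in>linear_parts. B *v v = v \<or> B *v v = - v}"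
    by blast
  obtain U' where "U ** U' = mat 1" "U' ** U = mat 1" using U(1) by (auto simp: invertible_def)
  then have "flat_Z2 G k U U'" by unfold_locales (use U(2) in auto)
  then show ?thesis by blast
qed

lemma mult_eq_card_freq:
  fixes G :: "'n::finite isom set"
  assumes "bieberbach_Z2 G k" and k: "k < CARD('n)"
  shows "mult_e G t = 2 ^ (CARD('n) - k - 1) * card (freq (transl_lattice G) t)"
    and "mult_o G t = 2 ^ (CARD('n) - k - 1) * card (freq (transl_lattice G) t)"
    and "mult_f G t = 2 ^ (CARD('n) - k) * card (freq (transl_lattice G) t)"
proof -
  obtain U U' where "flat_Z2 G k U U'" using bieberbach_Z2_flat[OF assms(1)] by blast
  then interpret flat_Z2 G k U U' .
  show e: "mult_e G t = 2 ^ (CARD('n) - k - 1) * card (freq L t)"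
    using mult_parity[OF k, where e = True and t = t] by (simp add: mult_e_def)
  show o: "mult_o G t = 2 ^ (CARD('n) - k - 1) * card (freq L t)"
    using mult_parity[OF k, where e = False and t = t] by (simp add: mult_o_def)
  have "mult_f G t = (\<Sum>p\<in>{p. p \<le> CARD('n) \<and> even p} \<union> {p. p \<le> CARD('n) \<and> odd p}. mult_p G p t)"
    unfolding mult_f_def by (rule sum.cong) auto
  also have "\<dots> = mult_e G t + mult_o G t"
    unfolding mult_e_def mult_o_def by (rule sum.union_disjoint) auto
  also have "\<dots> = 2 * 2 ^ (CARD('n) - k - 1) * card (freq L t)" by (simp add: e o)
  \<comment> \<open>Since \<open>k < CARD('n)\<close>, the truncated subtraction in the exponent
    loses nothing.\<close>
  also have "2 * 2 ^ (CARD('n) - k - 1) = (2::nat) ^ (CARD('n) - k)"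
    using k by (simp add: power_Suc[symmetric] del: power_Suc)
  finally show "mult_f G t = 2 ^ (CARD('n) - k) * card (freq L t)" .
qed

lemma freq_eq_dual_shell: "freq L (4 * pi^2 * \<mu>) = dual_shell L \<mu>"
  by (auto simp: freq_def dual_shell_def)

text \<open>Negative \<open>t\<close> adds no condition, because both frequency sets are then
  empty.\<close>

lemma lattice_isospectral_iff:
  "lattice_isospectral L L' \<longleftrightarrow> (\<forall>t. card (freq L t) = card (freq L' t))"
proof
  assume iso: "lattice_isospectral L L'"
  show "\<forall>t. card (freq L t) = card (freq L' t)"
  proof
    fix t
    have t: "t = 4 * pi^2 * (t / (4 * pi^2))" by simp
    show "card (freq L t) = card (freq L' t)"
    proof (cases "t \<ge> 0")
      case True
      then have "t / (4 * pi^2) \<ge> 0" by simp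
      then show ?thesis
        using iso unfolding lattice_isospectral_def by (subst (1 2) t) (simp only: freq_eq_dual_shell)
    next
      case False
      have "4 * pi^2 * (norm l)^2 \<noteq> t" for l :: "real^'a"
      proof -
        have "0 \<le> 4 * pi^2 * (norm l)^2" by simp
        then show ?thesis using False by linarith
      qed
      then have "freq L t = {}" "freq L' t = {}" by (auto simp: freq_def)
      then show ?thesis by simp
    qed
  qed
qed (auto simp: lattice_isospectral_def freq_eq_dual_shell[symmetric])

theorem theorem2p1:
  fixes G G' :: "'n::finite isom set" and k :: nat
  assumes "CARD('n) \<ge> 2" and "1 \<le> k" and "k \<le> CARD('n) - 1"
    and "bieberbach G" and "holonomy G \<cong> Z2_pow k"
    and "bieberbach G'" and "holonomy G' \<cong> Z2_pow k"
  shows "(\<forall>\<mu>\<ge>0.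
            mult_f G (4 * pi^2 * \<mu>) = 2^(CARD('n) - k) * card (dual_shell (transl_lattice G) \<mu>) \<and>
            mult_e G (4 * pi^2 * \<mu>) = 2^(CARD('n) - k - 1) * card (dual_shell (transl_lattice G) \<mu>) \<and>
            mult_o G (4 * pi^2 * \<mu>) = 2^(CARD('n) - k - 1) * card (dual_shell (transl_lattice G) \<mu>))
      \<and> (isospectral mult_f G G' \<longleftrightarrow> lattice_isospectral (transl_lattice G) (transl_lattice G'))
      \<and> (isospectral mult_e G G' \<longleftrightarrow> lattice_isospectral (transl_lattice G) (transl_lattice G'))
      \<and> (isospectral mult_o G G' \<longleftrightarrow> lattice_isospectral (transl_lattice G) (transl_lattice G'))
      \<and> (transl_lattice G = transl_lattice G' \<longrightarrow>
           isospectral mult_f G G' \<and> isospectral mult_e G G' \<and> isospectral mult_o G G')"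
proof -
  have k: "k < CARD('n)" using assms(1,3) by linarith
  have G: "bieberbach_Z2 G k" and G': "bieberbach_Z2 G' k"
    using assms(4-7) by (auto intro: bieberbach_Z2.intro)
  note G_mult = mult_eq_card_freq[OF G k] and G'_mult = mult_eq_card_freq[OF G' k]
  have iso: "isospectral mult_f G G' \<longleftrightarrow> lattice_isospectral (transl_lattice G) (transl_lattice G')"
    "isospectral mult_e G G' \<longleftrightarrow> lattice_isospectral (transl_lattice G) (transl_lattice G')"
    "isospectral mult_o G G' \<longleftrightarrow> lattice_isospectral (transl_lattice G) (transl_lattice G')"
    unfolding isospectral_def lattice_isospectral_iff G_mult G'_mult by auto
  then show ?thesis
    by (auto simp: G_mult freq_eq_dual_shell lattice_isospectral_def)
qed

end
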